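(* Let $(X,h_0,Y)$ be a principal $\mathfrak{sl}_2$-triple adapted to a Borel subalgebra $\mathfrak b\supseteq\mathfrak h$ of $\mathfrak g$, let $\overline\Sigma\colon \mathfrak h/W\to\mathfrak g$ be an associated Kostant section, and let $\Sigma\colon\mathfrak h\to\mathfrak g$ be the composition of $\overline\Sigma$ with the natural projection $\mathfrak h\to \mathfrak h/W$. Then there exists a morphism $\lambda\colon \mathfrak h\to G$ such that, for all $h\in \mathfrak h$, $$\operatorname{Ad}(\lambda(h))(\Sigma (h)) = h+X.$$
   Context: $G$ is a simple, simply connected complex linear algebraic group with Lie algebra $\mathfrak g$ of rank $r$; $H$ is a maximal torus, $\mathfrak h=\operatorname{Lie}H$, $W=W(G,H)$. Let $p\colon\mathfrak g\to\mathfrak h/W$ be the adjoint quotient morphism. An element of $\mathfrak g$ is regular if its centralizer has dimension $r$; $\mathfrak g_{\rm reg}$ is the set of regular elements. Let $\mathfrak u$ be the nilpotent radical of $\mathfrak b$. That $(X,h_0,Y)$ is a principal $\mathfrak{sl}_2$-triple adapted to $\mathfrak b$ means: $X\in\mathfrak u$ is a principal nilpotent element of $\mathfrak g$, $[h_0,X]=2X$, $[h_0,Y]=-2Y$, $[X,Y]=h_0\in\mathfrak h$. An associated Kostant section is defined by a linear subspace $Z\subseteq\mathfrak g$ complementary to $\operatorname{Im}(\operatorname{ad}X)$ and invariant under $\operatorname{ad}h_0$: Kostant proved that $Z+X\subseteq\mathfrak g_{\rm reg}$ and that $p$ restricts to an isomorphism $Z+X\to\mathfrak h/W$; the inverse isomorphism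 $\overline\Sigma\colon \mathfrak h/W\to Z+X\subseteq\mathfrak g$ is the Kostant section. *)

theory Defs
  imports "HOL-Analysis.Analysis" "HOL-Algebra.Group_Action" "HOL-Algebra.Product_Groups"
begin

section \<open>Affine varieties given by points and regular functions\<close>

inductive_set function_algebra :: "('a \<Rightarrow> complex) set \<Rightarrow> ('a \<Rightarrow> complex) set"
  for S :: "('a \<Rightarrow> complex) set" where
  gen: "f \<in> S \<Longrightarrow> f \<in> function_algebra S"
| const: "(\<lambda>_. c) \<in> function_algebra S"
| add: "f \<in> function_algebra S \<Longrightarrow> g \<in> function_algebra S \<Longrightarrow> (\<lambda>x. f x + g x) \<in> function_algebra S"
| mult: "f \<in> function_algebra S \<Longrightarrow> g \<in> function_algebra S \<Longrightarrow> (\<lambda>x. f x * g x) \<in> function_algebra S"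

text \<open>The elements of \<open>regs V\<close> are functions on the whole ambient type; only their
  restrictions to \<open>points V\<close> matter, and these restrictions form the coordinate ring.\<close>

record 'a variety =
  points :: "'a set"
  regs :: "('a \<Rightarrow> complex) set"

definition morphism :: "'a variety \<Rightarrow> 'b variety \<Rightarrow> ('a \<Rightarrow> 'b) \<Rightarrow> bool" where
  "morphism V V' \<phi> \<longleftrightarrow>
     \<phi> \<in> points V \<rightarrow> points V' \<and>
     (\<forall>q\<in>regs V'. \<exists>r\<in>regs V. \<forall>x\<in>points V. q (\<phi> x) = r x)"

definition inverse_isomorphisms ::
    "'a variety \<Rightarrow> 'b variety \<Rightarrow> ('a \<Rightarrow> 'b) \<Rightarrow> ('b \<Rightarrow> 'a) \<Rightarrow> bool" where
  "inverse_isomorphisms V V' \<phi> \<psi> \<longleftrightarrow>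
     morphism V V' \<phi> \<and> morphism V' V \<psi> \<and>
     (\<forall>x\<in>points V. \<psi> (\<phi> x) = x) \<and> (\<forall>y\<in>points V'. \<phi> (\<psi> y) = y)"

type_synonym 'n cmat = "complex ^ 'n ^ 'n"

definition polynomial_functions :: "('n::finite cmat \<Rightarrow> complex) set" where
  "polynomial_functions = function_algebra {\<lambda>A. A $ i $ j |i j. True}"

definition GL_regular_functions :: "('n::finite cmat \<Rightarrow> complex) set" where
  "GL_regular_functions =
     function_algebra ({\<lambda>A. A $ i $ j |i j. True} \<union> {\<lambda>A. inverse (det A)})"

text \<open>For Zariski closed subsets of the affine space of matrices (here: affine subspaces).\<close>

definition affine_variety :: "'n::finite cmat set \<Rightarrow> 'n cmat variety" where
  "affine_variety S = \<lparr>points = S, regs = polynomial_functions\<rparr>"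

text \<open>For Zariski closed subsets of the general linear group.\<close>

definition group_variety :: "'n::finite cmat set \<Rightarrow> 'n cmat variety" where
  "group_variety G = \<lparr>points = G, regs = GL_regular_functions\<rparr>"


section \<open>Linear algebraic groups\<close>

definition GL :: "'n::finite cmat monoid" where
  "GL = \<lparr>carrier = {A. invertible A}, monoid.mult = (**), one = mat 1\<rparr>"

abbreviation grp :: "'n::finite cmat set \<Rightarrow> 'n cmat monoid" where
  "grp G \<equiv> GL\<lparr>carrier := G\<rparr>"

definition zariski_closed :: "'n::finite cmat set \<Rightarrow> bool" where
  "zariski_closed S \<longleftrightarrow>
     (\<exists>F \<subseteq> GL_regular_functions. S = {A. invertible A \<and> (\<forall>f\<in>F. f A = 0)})"

definition zariski_connected :: "'n::finite cmat set \<Rightarrow> bool" where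
  "zariski_connected S \<longleftrightarrow>
     \<not> (\<exists>A B. zariski_closed A \<and> zariski_closed B \<and> S \<subseteq> A \<union> B \<and>
              A \<inter> B \<inter> S = {} \<and> A \<inter> S \<noteq> {} \<and> B \<inter> S \<noteq> {})"

definition linear_algebraic_group :: "'n::finite cmat set \<Rightarrow> bool" where
  "linear_algebraic_group G \<longleftrightarrow> subgroup G GL \<and> zariski_closed G"

text \<open>Simple as an algebraic group: a finite centre is allowed.\<close>

definition simple_algebraic_group :: "'n::finite cmat set \<Rightarrow> bool" where
  "simple_algebraic_group G \<longleftrightarrow>
     linear_algebraic_group G \<and> zariski_connected G \<and>
     (\<exists>x\<in>G. \<exists>y\<in>G. x ** y \<noteq> y ** x) \<and>
     (\<forall>N. N \<lhd> grp G \<and> zariski_closed N \<and> zariski_connected N \<longrightarrow> N = {mat 1} \<or> N = G)"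

definition Gm :: "complex monoid" where
  "Gm = \<lparr>carrier = UNIV - {0}, monoid.mult = (*), one = 1\<rparr>"

definition Gm_power :: "nat \<Rightarrow> (nat \<Rightarrow> complex) monoid" where
  "Gm_power k = product_group {..<k} (\<lambda>_. Gm)"

definition Gm_power_variety :: "nat \<Rightarrow> (nat \<Rightarrow> complex) variety" where
  "Gm_power_variety k =
     \<lparr>points = carrier (Gm_power k),
      regs = function_algebra ({\<lambda>z. z i |i. i < k} \<union> {\<lambda>z. inverse (z i) |i. i < k})\<rparr>"

definition torus :: "'n::finite cmat set \<Rightarrow> bool" where
  "torus T \<longleftrightarrow> linear_algebraic_group T \<and>
     (\<exists>k \<phi> \<psi>. \<phi> \<in> hom (Gm_power k) (grp T) \<and>
        inverse_isomorphisms (Gm_power_variety k) (group_variety T) \<phi> \<psi>)"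

definition maximal_torus :: "'n::finite cmat set \<Rightarrow> 'n cmat set \<Rightarrow> bool" where
  "maximal_torus G H \<longleftrightarrow> torus H \<and> H \<subseteq> G \<and> (\<forall>T. torus T \<and> H \<subseteq> T \<and> T \<subseteq> G \<longrightarrow> T = H)"


section \<open>Lie algebras\<close>

definition cscale :: "complex \<Rightarrow> 'n::finite cmat \<Rightarrow> 'n cmat" where
  "cscale c A = (\<chi> i j. c * A $ i $ j)"

interpretation cmat: vector_space "cscale :: complex \<Rightarrow> 'n::finite cmat \<Rightarrow> 'n cmat"
  by unfold_locales (simp_all add: cscale_def vec_eq_iff algebra_simps)

text \<open>The tangent space at the identity: the tangent vectors killed by the differentials of
  all regular functions vanishing on the group.\<close>

definition Lie :: "'n::finite cmat set \<Rightarrow> 'n cmat set" where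
  "Lie G = {A. \<forall>f\<in>GL_regular_functions. (\<forall>x\<in>G. f x = 0) \<longrightarrow>
      ((\<lambda>t::complex. f (mat 1 + cscale t A)) has_field_derivative 0) (at 0)}"

definition Ad :: "'n::finite cmat \<Rightarrow> 'n cmat \<Rightarrow> 'n cmat" where
  "Ad x A = x ** A ** matrix_inv x"

definition lie :: "'n::finite cmat \<Rightarrow> 'n cmat \<Rightarrow> 'n cmat" where
  "lie A B = A ** B - B ** A"

definition lie_span :: "'n::finite cmat set \<Rightarrow> 'n cmat set \<Rightarrow> 'n cmat set" where
  "lie_span S T = cmat.span {lie A B |A B. A \<in> S \<and> B \<in> T}"

definition lie_subalgebra :: "'n::finite cmat set \<Rightarrow> 'n cmat set \<Rightarrow> bool" where
  "lie_subalgebra L M \<longleftrightarrow> M \<subseteq> L \<and> cmat.subspace M \<and> (\<forall>A\<in>M. \<forall>B\<in>M. lie A B \<in> M)"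

definition lie_ideal :: "'n::finite cmat set \<Rightarrow> 'n cmat set \<Rightarrow> bool" where
  "lie_ideal L M \<longleftrightarrow> M \<subseteq> L \<and> cmat.subspace M \<and> (\<forall>A\<in>L. \<forall>B\<in>M. lie A B \<in> M)"

definition solvable_lie :: "'n::finite cmat set \<Rightarrow> bool" where
  "solvable_lie L \<longleftrightarrow> (\<exists>k. ((\<lambda>M. lie_span M M) ^^ k) L = {0})"

definition nilpotent_lie :: "'n::finite cmat set \<Rightarrow> bool" where
  "nilpotent_lie L \<longleftrightarrow> (\<exists>k. (lie_span L ^^ k) L = {0})"

definition borel_subalgebra :: "'n::finite cmat set \<Rightarrow> 'n cmat set \<Rightarrow> bool" where
  "borel_subalgebra L B \<longleftrightarrow> lie_subalgebra L B \<and> solvable_lie B \<and>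
     (\<forall>M. lie_subalgebra L M \<and> solvable_lie M \<and> B \<subseteq> M \<longrightarrow> M = B)"

text \<open>The sum of all nilpotent ideals, which is the largest nilpotent ideal.\<close>

definition nilpotent_radical :: "'n::finite cmat set \<Rightarrow> 'n cmat set" where
  "nilpotent_radical L = cmat.span (\<Union>{M. lie_ideal L M \<and> nilpotent_lie M})"

definition lie_centralizer :: "'n::finite cmat set \<Rightarrow> 'n cmat \<Rightarrow> 'n cmat set" where
  "lie_centralizer L A = {B\<in>L. lie A B = 0}"

definition nilpotent_element :: "'n::finite cmat set \<Rightarrow> 'n cmat \<Rightarrow> bool" where
  "nilpotent_element L A \<longleftrightarrow> A \<in> L \<and> (\<exists>k. \<forall>B\<in>L. (lie A ^^ k) B = 0)"

text \<open>The rank is the dimension of a maximal torus \<open>H\<close> of \<open>G\<close>.\<close>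

definition regular_elements :: "'n::finite cmat set \<Rightarrow> 'n cmat set \<Rightarrow> 'n cmat set" where
  "regular_elements G H =
     {A \<in> Lie G. cmat.dim (lie_centralizer (Lie G) A) = cmat.dim (Lie H)}"

definition principal_nilpotent :: "'n::finite cmat set \<Rightarrow> 'n cmat set \<Rightarrow> 'n cmat \<Rightarrow> bool" where
  "principal_nilpotent G H X \<longleftrightarrow> nilpotent_element (Lie G) X \<and> X \<in> regular_elements G H"

definition adapted_principal_sl2_triple ::
    "'n::finite cmat set \<Rightarrow> 'n cmat set \<Rightarrow> 'n cmat set \<Rightarrow> 'n cmat \<Rightarrow> 'n cmat \<Rightarrow> 'n cmat \<Rightarrow> bool" where
  "adapted_principal_sl2_triple G H \<bb> X h\<^sub>0 Y \<longleftrightarrow>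
     X \<in> nilpotent_radical \<bb> \<and> principal_nilpotent G H X \<and> h\<^sub>0 \<in> Lie H \<and> Y \<in> Lie G \<and>
     lie h\<^sub>0 X = cscale 2 X \<and> lie h\<^sub>0 Y = cscale (-2) Y \<and> lie X Y = h\<^sub>0"


section \<open>The adjoint quotient and Kostant sections\<close>

text \<open>The Weyl group $N_G(H)/H$ in its faithful representation on \<open>Lie H\<close>.\<close>

definition weyl_group :: "'n::finite cmat set \<Rightarrow> 'n cmat set \<Rightarrow> ('n cmat \<Rightarrow> 'n cmat) set" where
  "weyl_group G H = {restrict (Ad x) (Lie H) |x. x \<in> normalizer (grp G) H}"

definition weyl_orbit :: "'n::finite cmat set \<Rightarrow> 'n cmat set \<Rightarrow> 'n cmat \<Rightarrow> 'n cmat set" where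
  "weyl_orbit G H h = {w h |w. w \<in> weyl_group G H}"

text \<open>The quotient of \<open>Lie H\<close> by the Weyl group: its points are the orbits and its coordinate ring
  is the ring of Weyl invariant polynomial functions on \<open>Lie H\<close>.\<close>

definition weyl_quotient :: "'n::finite cmat set \<Rightarrow> 'n cmat set \<Rightarrow> 'n cmat set variety" where
  "weyl_quotient G H =
     \<lparr>points = weyl_orbit G H ` Lie H,
      regs = {F. \<exists>f\<in>polynomial_functions. \<forall>h\<in>Lie H. F (weyl_orbit G H h) = f h}\<rparr>"

definition invariant_polynomials :: "'n::finite cmat set \<Rightarrow> ('n cmat \<Rightarrow> complex) set" where
  "invariant_polynomials G =
     {f \<in> polynomial_functions. \<forall>x\<in>G. \<forall>A\<in>Lie G. f (Ad x A) = f A}"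

text \<open>By Chevalley's restriction theorem, restriction to \<open>Lie H\<close> identifies the ring of
  \<open>G\<close>-invariant polynomial functions on \<open>Lie G\<close> with the coordinate ring of the Weyl quotient.
  The adjoint quotient is the morphism induced by this identification: it sends \<open>A\<close> to the unique
  Weyl orbit on which every invariant polynomial takes the same value as at \<open>A\<close>.\<close>

definition adjoint_quotient ::
    "'n::finite cmat set \<Rightarrow> 'n cmat set \<Rightarrow> 'n cmat \<Rightarrow> 'n cmat set" where
  "adjoint_quotient G H A = {h \<in> Lie H. \<forall>f\<in>invariant_polynomials G. f h = f A}"

definition kostant_section ::
    "'n::finite cmat set \<Rightarrow> 'n cmat set \<Rightarrow> 'n cmat \<Rightarrow> 'n cmat \<Rightarrow> ('n cmat set \<Rightarrow> 'n cmat) \<Rightarrow> bool" where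
  "kostant_section G H X h\<^sub>0 \<sigma> \<longleftrightarrow>
     (\<exists>Z. Z \<subseteq> Lie G \<and> cmat.subspace Z \<and>
        Z \<inter> lie X ` Lie G = {0} \<and> Lie G = {A + B |A B. A \<in> Z \<and> B \<in> lie X ` Lie G} \<and>
        (\<forall>A\<in>Z. lie h\<^sub>0 A \<in> Z) \<and>
        inverse_isomorphisms (affine_variety ((\<lambda>A. A + X) ` Z)) (weyl_quotient G H)
          (adjoint_quotient G H) \<sigma>)"

end

theory Submission
  imports Defs "HOL-Computational_Algebra.Polynomial"
begin

text \<open>
  The proof is Kostant's reduction to the slice, carried out with parameters. Write \<open>L\<close> for the Lie
  algebra of \<open>G\<close> and grade the matrices by the generalized eigenspaces of \<open>ad h\<^sub>0\<close>. The element \<open>X\<close> has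
  weight \<open>2\<close>, and every \<open>h\<close> in the Lie algebra of the torus has weight \<open>0\<close>, because \<open>h\<^sub>0\<close> lies there
  too and the torus is commutative. Since \<open>L = Z + [X, L]\<close> and \<open>Z\<close> is stable under \<open>ad h\<^sub>0\<close>, the
  component of weight \<open>-2k\<close>, \<open>k \<ge> 0\<close>, of an element of \<open>L\<close> can be written as \<open>z + [X, n]\<close> with \<open>z \<in> Z\<close> and \<open>n\<close> of
  weight \<open>-2k - 2\<close>. Conjugation by \<open>exp n\<close> replaces this component by \<open>z\<close> and changes nothing else except
  components of lower weight. Starting from \<open>h + X\<close> and treating the weights \<open>0, -2, -4, \<dots>\<close> in turn, one
  reaches \<open>Z + X\<close> after finitely many steps. As \<open>n\<close> can be chosen to depend linearly on the
  element to be modified, and as \<open>n\<close> is a nilpotent matrix, so that \<open>exp n\<close> is a polynomial in \<open>n\<close>, the conjugating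
  element depends polynomially on \<open>h\<close> (\<open>conjugate_into_slice\<close>).

  It remains to see that the point \<open>s\<close> of \<open>Z + X\<close> so obtained is the value of the section at \<open>h\<close>, that
  is, that the adjoint quotient maps \<open>s\<close> to the Weyl orbit of \<open>h\<close>. Invariant polynomials agree at \<open>s\<close>
  and at its conjugate \<open>h + X\<close>; and they agree at \<open>h + X\<close> and at \<open>h\<close>, because \<open>ad h\<^sub>0\<close> generates a flow
  that scales \<open>X\<close> and fixes \<open>h\<close> (\<open>invariant_polynomial_shift\<close>). The inverse of the conjugating element is the
  morphism sought.

  Three facts about a linear algebraic group are derived from the description of its Lie algebra by
  differentials of vanishing functions: the Lie algebra is stable under the adjoint action (\<open>Ad_Lie\<close>)
  and under brackets (\<open>lie_Lie\<close>), and it exponentiates into the group on nilpotent matrices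
  (\<open>exp_truncated_in_group\<close>).
\<close>

section \<open>Regular functions and their gradients\<close>

text \<open>Agreement with a regular function is only required on \<open>D\<close>: matrix inversion, for
  instance, is given by regular functions on the invertible matrices, whereas
  \<open>matrix_inv\<close> takes unspecified values elsewhere.\<close>

definition regular_on :: "('a \<Rightarrow> complex) set \<Rightarrow> 'a set \<Rightarrow> ('a \<Rightarrow> complex) \<Rightarrow> bool" where
  "regular_on S D f \<longleftrightarrow> (\<exists>r\<in>function_algebra S. \<forall>x\<in>D. f x = r x)"

definition regular_matrix_on :: "('a \<Rightarrow> complex) set \<Rightarrow> 'a set \<Rightarrow> ('a \<Rightarrow> 'n::finite cmat) \<Rightarrow> bool" where
  "regular_matrix_on S D F \<longleftrightarrow> (\<forall>i j. regular_on S D (\<lambda>x. F x $ i $ j))"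

abbreviation matrix_entries :: "('n::finite cmat \<Rightarrow> complex) set" where
  "matrix_entries \<equiv> {\<lambda>A. A $ i $ j |i j. True}"

abbreviation GL_generators :: "('n::finite cmat \<Rightarrow> complex) set" where
  "GL_generators \<equiv> matrix_entries \<union> {\<lambda>A. inverse (det A)}"

lemma regular_on_cong:
  "regular_on S D f \<Longrightarrow> (\<And>x. x \<in> D \<Longrightarrow> f x = g x) \<Longrightarrow> regular_on S D g"
  unfolding regular_on_def by metis

lemma regular_on_function_algebra: "f \<in> function_algebra S \<Longrightarrow> regular_on S D f"
  unfolding regular_on_def by blast

lemma regular_on_const: "regular_on S D (\<lambda>_. c)"
  by (intro regular_on_function_algebra function_algebra.const)

lemma regular_on_add:
  assumes "regular_on S D f" "regular_on S D g"
  shows "regular_on S D (\<lambda>x. f x + g x)"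
proof -
  obtain r q where "r \<in> function_algebra S" "\<forall>x\<in>D. f x = r x"
      "q \<in> function_algebra S" "\<forall>x\<in>D. g x = q x"
    using assms unfolding regular_on_def by blast
  then show ?thesis
    unfolding regular_on_def by (intro bexI[OF _ function_algebra.add[of r S q]]) auto
qed

lemma regular_on_mult:
  assumes "regular_on S D f" "regular_on S D g"
  shows "regular_on S D (\<lambda>x. f x * g x)"
proof -
  obtain r q where "r \<in> function_algebra S" "\<forall>x\<in>D. f x = r x"
      "q \<in> function_algebra S" "\<forall>x\<in>D. g x = q x"
    using assms unfolding regular_on_def by blast
  then show ?thesis
    unfolding regular_on_def by (intro bexI[OF _ function_algebra.mult[of r S q]]) auto
qed

lemma regular_on_diff:
  assumes "regular_on S D f" "regular_on S D g"
  shows "regular_on S D (\<lambda>x. f x - g x)"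
  using regular_on_add[OF assms(1) regular_on_mult[OF regular_on_const[of _ _ "-1"] assms(2)]] by simp

lemma regular_on_sum:
  assumes "\<And>i. i \<in> I \<Longrightarrow> regular_on S D (f i)"
  shows "regular_on S D (\<lambda>x. \<Sum>i\<in>I. f i x)"
  using assms
  by (induction I rule: infinite_finite_induct) (auto intro: regular_on_const regular_on_add)

lemma regular_on_prod:
  assumes "\<And>i. i \<in> I \<Longrightarrow> regular_on S D (f i)"
  shows "regular_on S D (\<lambda>x. \<Prod>i\<in>I. f i x)"
  using assms
  by (induction I rule: infinite_finite_induct) (auto intro: regular_on_const regular_on_mult)

lemma regular_matrix_on_const: "regular_matrix_on S D (\<lambda>_. A)"
  unfolding regular_matrix_on_def by (simp add: regular_on_const)

lemma regular_matrix_on_add: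
  "regular_matrix_on S D F \<Longrightarrow> regular_matrix_on S D F' \<Longrightarrow> regular_matrix_on S D (\<lambda>x. F x + F' x)"
  unfolding regular_matrix_on_def by (simp add: regular_on_add)

lemma regular_matrix_on_diff:
  "regular_matrix_on S D F \<Longrightarrow> regular_matrix_on S D F' \<Longrightarrow> regular_matrix_on S D (\<lambda>x. F x - F' x)"
  unfolding regular_matrix_on_def by (simp add: regular_on_diff)

lemma regular_matrix_on_cscale:
  "regular_on S D f \<Longrightarrow> regular_matrix_on S D F \<Longrightarrow> regular_matrix_on S D (\<lambda>x. cscale (f x) (F x))"
  unfolding regular_matrix_on_def cscale_def by (simp add: regular_on_mult)

lemma regular_matrix_on_mult:
  "regular_matrix_on S D F \<Longrightarrow> regular_matrix_on S D F' \<Longrightarrow> regular_matrix_on S D (\<lambda>x. F x ** F' x)"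
  unfolding regular_matrix_on_def matrix_matrix_mult_def
  by (simp add: regular_on_sum regular_on_mult)

lemma regular_matrix_on_sum:
  assumes "\<And>i. i \<in> I \<Longrightarrow> regular_matrix_on S D (F i)"
  shows "regular_matrix_on S D (\<lambda>x. \<Sum>i\<in>I. F i x)"
  using assms
  by (induction I rule: infinite_finite_induct)
    (auto intro: regular_matrix_on_const regular_matrix_on_add)

lemma regular_matrix_on_ident: "matrix_entries \<subseteq> S \<Longrightarrow> regular_matrix_on S D (\<lambda>A. A)"
  unfolding regular_matrix_on_def
  by (intro allI regular_on_function_algebra function_algebra.gen) auto

lemma regular_on_det: "regular_matrix_on S D F \<Longrightarrow> regular_on S D (\<lambda>x. det (F x))"
  unfolding det_def regular_matrix_on_def
  by (intro regular_on_sum regular_on_mult regular_on_const regular_on_prod) auto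

lemma det_polynomial: "(det :: 'n::finite cmat \<Rightarrow> complex) \<in> polynomial_functions"
proof -
  have "regular_on matrix_entries UNIV (det :: 'n cmat \<Rightarrow> complex)"
    by (intro regular_on_det regular_matrix_on_ident) auto
  then obtain r where "r \<in> polynomial_functions" "(det :: 'n cmat \<Rightarrow> complex) = r"
    unfolding regular_on_def polynomial_functions_def by blast
  then show ?thesis by simp
qed

lemma regular_on_compose_polynomial:
  assumes "f \<in> polynomial_functions" "regular_matrix_on S D F"
  shows "regular_on S D (\<lambda>x. f (F x))"
  using assms(1) unfolding polynomial_functions_def
proof induction
  case (gen f)
  then show ?case using assms(2) unfolding regular_matrix_on_def by auto
qed (auto intro: regular_on_const regular_on_add regular_on_mult)

lemma regular_on_compose_GL:
  assumes "f \<in> GL_regular_functions" "regular_matrix_on S D F"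
    and "regular_on S D (\<lambda>x. inverse (det (F x)))"
  shows "regular_on S D (\<lambda>x. f (F x))"
  using assms(1) unfolding GL_regular_functions_def
proof induction
  case (gen f)
  then show ?case using assms(2,3) unfolding regular_matrix_on_def by auto
qed (auto intro: regular_on_const regular_on_add regular_on_mult)

text \<open>The function \<open>inverse \<circ> det\<close> is the only obstacle to composing regular
  functions with a matrix of regular functions. An inverse matrix \<open>F'\<close> of regular
  functions removes it, as \<open>inverse (det F) = det F'\<close>.\<close>

lemma regular_on_compose_invertible:
  assumes f: "f \<in> GL_regular_functions"
    and F: "regular_matrix_on S D F" "regular_matrix_on S D F'"
    and inv: "\<And>x. x \<in> D \<Longrightarrow> F x ** F' x = mat 1"
  shows "regular_on S D (\<lambda>x. f (F x))"
proof (rule regular_on_compose_GL[OF f F(1)])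
  have "inverse (det (F x)) = det (F' x)" if "x \<in> D" for x
    using arg_cong[OF inv[OF that], of det] by (intro inverse_unique) (simp add: det_mul)
  then show "regular_on S D (\<lambda>x. inverse (det (F x)))"
    by (metis (no_types, lifting) regular_on_cong regular_on_det[OF F(2)])
qed

lemma matrix_inv_inverse:
  assumes "invertible A"
  shows "A ** matrix_inv A = mat 1" "matrix_inv A ** A = mat 1"
  using assms someI_ex[of "\<lambda>A'. A ** A' = mat 1 \<and> A' ** A = mat 1"]
  unfolding invertible_def matrix_inv_def by auto

lemma matrix_inv_eq:
  fixes A B :: "'n::finite cmat"
  assumes "A ** B = mat 1"
  shows "matrix_inv A = B"
proof -
  have "invertible A" using assms matrix_left_right_inverse[of A B] unfolding invertible_def by blast
  then show ?thesis
    using matrix_inv_inverse(2)[of A] assms by (metis matrix_mul_assoc matrix_mul_lid matrix_mul_rid)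
qed

text \<open>By Cramer's rule.\<close>

lemma regular_matrix_inv:
  "regular_matrix_on GL_generators {A :: 'n::finite cmat. invertible A} matrix_inv"
proof -
  let ?D = "{A :: 'n cmat. invertible A}"
  let ?C = "\<lambda>(A :: 'n cmat) k l. (\<chi> i j. if j = k then axis l 1 $ i else A $ i $ j) :: 'n cmat"
  have "regular_on GL_generators ?D (\<lambda>A. det (?C A k l) * inverse (det A))" for k l :: 'n
  proof (intro regular_on_mult regular_on_det)
    show "regular_on GL_generators ?D (\<lambda>A. inverse (det A))"
      by (intro regular_on_function_algebra function_algebra.gen) auto
    have "regular_matrix_on GL_generators ?D (\<lambda>A. A)"
      by (intro regular_matrix_on_ident) auto
    then show "regular_matrix_on GL_generators ?D (\<lambda>A. ?C A k l)"
      unfolding regular_matrix_on_def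
    proof (intro allI)
      fix i j assume "\<forall>i j. regular_on GL_generators ?D (\<lambda>A. A $ i $ j)"
      then show "regular_on GL_generators ?D (\<lambda>A. ?C A k l $ i $ j)"
        by (cases "j = k") (simp_all add: regular_on_const)
    qed
  qed
  moreover have "det (?C A k l) * inverse (det A) = matrix_inv A $ k $ l"
    if "invertible A" for A :: "'n cmat" and k l
  proof -
    have "A *v (matrix_inv A *v axis l 1) = axis l 1"
      by (simp add: matrix_vector_mul_assoc matrix_inv_inverse that)
    then have "matrix_inv A *v axis l 1 = (\<chi> k. det (?C A k l) / det A)"
      using cramer[of A "matrix_inv A *v axis l 1" "axis l 1"] that
      by (simp add: invertible_det_nz)
    moreover have "(matrix_inv A *v axis l 1) $ k = matrix_inv A $ k $ l"
      by (simp add: matrix_vector_mul_component inner_axis' row_def inner_vec_def axis_def matrix_vector_mult_def if_distrib cong: if_cong)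
    ultimately show ?thesis by (simp add: divide_inverse)
  qed
  ultimately show ?thesis
    unfolding regular_matrix_on_def by (metis (no_types, lifting) regular_on_cong mem_Collect_eq)
qed

text \<open>The complex derivative of a curve of matrices, taken entry by entry:
  \<open>has_vector_derivative\<close> is about curves with a real parameter.\<close>

definition has_matrix_derivative :: "(complex \<Rightarrow> 'n::finite cmat) \<Rightarrow> 'n cmat \<Rightarrow> complex \<Rightarrow> bool" where
  "has_matrix_derivative \<gamma> \<gamma>' t \<longleftrightarrow>
     (\<forall>i j. ((\<lambda>s. \<gamma> s $ i $ j) has_field_derivative \<gamma>' $ i $ j) (at t))"

lemma has_matrix_derivative_const: "has_matrix_derivative (\<lambda>_. A) 0 t"
  unfolding has_matrix_derivative_def by simp

lemma has_matrix_derivative_add: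
  "has_matrix_derivative \<gamma> \<gamma>' t \<Longrightarrow> has_matrix_derivative \<delta> \<delta>' t \<Longrightarrow>
    has_matrix_derivative (\<lambda>s. \<gamma> s + \<delta> s) (\<gamma>' + \<delta>') t"
  unfolding has_matrix_derivative_def by (auto intro!: derivative_eq_intros)

lemma has_matrix_derivative_sum:
  assumes "\<And>i. i \<in> I \<Longrightarrow> has_matrix_derivative (\<gamma> i) (\<gamma>' i) t"
  shows "has_matrix_derivative (\<lambda>s. \<Sum>i\<in>I. \<gamma> i s) (\<Sum>i\<in>I. \<gamma>' i) t"
  using assms
  by (induction I rule: infinite_finite_induct)
    (auto intro: has_matrix_derivative_const has_matrix_derivative_add)

lemma has_matrix_derivative_cscale:
  "(f has_field_derivative f') (at t) \<Longrightarrow> has_matrix_derivative (\<lambda>s. cscale (f s) A) (cscale f' A) t"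
  unfolding has_matrix_derivative_def cscale_def by (auto intro!: derivative_eq_intros)

lemma has_matrix_derivative_line: "has_matrix_derivative (\<lambda>s. A + cscale s B) B t"
  unfolding has_matrix_derivative_def cscale_def by (auto intro!: derivative_eq_intros)

lemma has_matrix_derivative_mult:
  "has_matrix_derivative \<gamma> \<gamma>' t \<Longrightarrow> has_matrix_derivative \<delta> \<delta>' t \<Longrightarrow>
    has_matrix_derivative (\<lambda>s. \<gamma> s ** \<delta> s) (\<gamma>' ** \<delta> t + \<gamma> t ** \<delta>') t"
  unfolding has_matrix_derivative_def matrix_matrix_mult_def
  by (auto intro!: derivative_eq_intros simp: sum.distrib[symmetric] algebra_simps)

lemma has_matrix_derivative_unique:
  "has_matrix_derivative \<gamma> A t \<Longrightarrow> has_matrix_derivative \<gamma> B t \<Longrightarrow> A = B"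
  unfolding has_matrix_derivative_def by (metis DERIV_unique vec_eq_iff)

text \<open>The chain rule for curves that pass through \<open>D\<close> at the time in question; \<open>d i
  j\<close> is the partial derivative with respect to the entry \<open>(i, j)\<close>.\<close>

definition has_gradient_on ::
    "'n::finite cmat set \<Rightarrow> ('n cmat \<Rightarrow> complex) \<Rightarrow> ('n \<Rightarrow> 'n \<Rightarrow> 'n cmat \<Rightarrow> complex) \<Rightarrow> bool" where
  "has_gradient_on D f d \<longleftrightarrow> (\<forall>\<gamma> \<gamma>' t. has_matrix_derivative \<gamma> \<gamma>' t \<longrightarrow> \<gamma> t \<in> D \<longrightarrow>
     ((\<lambda>s. f (\<gamma> s)) has_field_derivative (\<Sum>i\<in>UNIV. \<Sum>j\<in>UNIV. d i j (\<gamma> t) * \<gamma>' $ i $ j)) (at t))"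

lemma has_gradient_onD:
  "has_gradient_on D f d \<Longrightarrow> has_matrix_derivative \<gamma> \<gamma>' t \<Longrightarrow> \<gamma> t \<in> D \<Longrightarrow>
     ((\<lambda>s. f (\<gamma> s)) has_field_derivative (\<Sum>i\<in>UNIV. \<Sum>j\<in>UNIV. d i j (\<gamma> t) * \<gamma>' $ i $ j)) (at t)"
  unfolding has_gradient_on_def by blast

lemma has_gradient_on_entry:
  "has_gradient_on D (\<lambda>A :: 'n::finite cmat. A $ k $ l) (\<lambda>i j _. if i = k \<and> j = l then 1 else 0)"
proof -
  have "(\<Sum>i\<in>UNIV. \<Sum>j\<in>UNIV. (if i = k \<and> j = l then 1 else 0) * \<gamma>' $ i $ j) = \<gamma>' $ k $ l"
    for \<gamma>' :: "'n cmat"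
    by (subst sum.cong[OF refl, where h = "\<lambda>i. if i = k then \<gamma>' $ i $ l else 0"])
      (auto simp: if_distrib[of "\<lambda>c. c * _"] if_distribR cong: if_cong)
  then show ?thesis
    unfolding has_gradient_on_def has_matrix_derivative_def by simp
qed

text \<open>By the sum and product rules, it is enough to differentiate generators.\<close>

lemma function_algebra_gradient:
  assumes "f \<in> function_algebra S"
    and gen: "\<And>f. f \<in> S \<Longrightarrow> \<exists>d. (\<forall>i j. d i j \<in> function_algebra S) \<and> has_gradient_on D f d"
  shows "\<exists>d. (\<forall>i j. d i j \<in> function_algebra S) \<and> has_gradient_on D f d"
  using assms(1)
proof induction
  case (gen f)
  then show ?case by (rule assms(2))
next
  case (const c)
  show ?case
    by (intro exI[of _ "\<lambda>_ _ _. 0"]) (simp add: function_algebra.const has_gradient_on_def)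
next
  case (add f g)
  then obtain d e where de: "\<forall>i j. d i j \<in> function_algebra S" "has_gradient_on D f d"
      "\<forall>i j. e i j \<in> function_algebra S" "has_gradient_on D g e"
    by blast
  have "has_gradient_on D (\<lambda>x. f x + g x) (\<lambda>i j x. d i j x + e i j x)"
    unfolding has_gradient_on_def
    using DERIV_add[OF has_gradient_onD[OF de(2)] has_gradient_onD[OF de(4)]]
    by (simp add: algebra_simps sum.distrib)
  then show ?case
    using de(1,3) by (intro exI[of _ "\<lambda>i j x. d i j x + e i j x"]) (simp add: function_algebra.add)
next
  case (mult f g)
  then obtain d e where de: "\<forall>i j. d i j \<in> function_algebra S" "has_gradient_on D f d"
      "\<forall>i j. e i j \<in> function_algebra S" "has_gradient_on D g e"
    by blast
  have "has_gradient_on D (\<lambda>x. f x * g x) (\<lambda>i j x. d i j x * g x + f x * e i j x)"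
    unfolding has_gradient_on_def
    using DERIV_mult[OF has_gradient_onD[OF de(2)] has_gradient_onD[OF de(4)]]
    by (simp add: algebra_simps sum.distrib sum_distrib_left)
  then show ?case
    using de(1,3) mult.hyps
    by (intro exI[of _ "\<lambda>i j x. d i j x * g x + f x * e i j x"])
      (simp add: function_algebra.add function_algebra.mult)
qed

lemma polynomial_gradient:
  assumes "f \<in> polynomial_functions"
  shows "\<exists>d. (\<forall>i j. d i j \<in> polynomial_functions) \<and> has_gradient_on UNIV f d"
proof -
  have "\<exists>d. (\<forall>i j. d i j \<in> function_algebra matrix_entries) \<and> has_gradient_on UNIV f d"
    using assms unfolding polynomial_functions_def
  proof (rule function_algebra_gradient)
    fix g :: "'a cmat \<Rightarrow> complex" assume "g \<in> matrix_entries"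
    then obtain k l where "g = (\<lambda>A. A $ k $ l)" by blast
    then show "\<exists>d. (\<forall>i j. d i j \<in> function_algebra matrix_entries) \<and> has_gradient_on UNIV g d"
      using has_gradient_on_entry[of UNIV k l]
      by (intro exI[of _ "\<lambda>i j _. if i = k \<and> j = l then 1 else 0"]) (simp add: function_algebra.const)
  qed
  then show ?thesis unfolding polynomial_functions_def .
qed

lemma polynomial_functions_subset_GL:
  "(polynomial_functions :: ('n::finite cmat \<Rightarrow> complex) set) \<subseteq> GL_regular_functions"
proof
  fix f :: "'n cmat \<Rightarrow> complex" assume "f \<in> polynomial_functions"
  then show "f \<in> GL_regular_functions" unfolding polynomial_functions_def GL_regular_functions_def
    by induction (auto intro: function_algebra.intros)
qed

lemma GL_gradient:
  assumes "f \<in> GL_regular_functions"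
  shows "\<exists>d. (\<forall>i j. d i j \<in> GL_regular_functions) \<and> has_gradient_on {A. invertible A} f d"
proof -
  let ?D = "{A. invertible A}"
  have "\<exists>d. (\<forall>i j. d i j \<in> function_algebra GL_generators) \<and> has_gradient_on ?D f d"
    using assms unfolding GL_regular_functions_def
  proof (rule function_algebra_gradient)
    fix g :: "'a cmat \<Rightarrow> complex" assume "g \<in> GL_generators"
    then consider k l where "g = (\<lambda>A. A $ k $ l)" | "g = (\<lambda>A. inverse (det A))" by blast
    then show "\<exists>d. (\<forall>i j. d i j \<in> function_algebra GL_generators) \<and> has_gradient_on ?D g d"
    proof cases
      case 1
      then show ?thesis
        using has_gradient_on_entry[of ?D k l]
        by (intro exI[of _ "\<lambda>i j _. if i = k \<and> j = l then 1 else 0"]) (simp add: function_algebra.const)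
    next
      case 2
      from polynomial_gradient[OF det_polynomial] obtain d where
        "(\<forall>i j. d i j \<in> polynomial_functions) \<and> has_gradient_on UNIV (det :: 'a cmat \<Rightarrow> complex) d" ..
      then have d: "\<And>i j. d i j \<in> polynomial_functions"
          "has_gradient_on UNIV (det :: 'a cmat \<Rightarrow> complex) d"
        by auto
      let ?e = "\<lambda>i j A. (- 1) * (inverse (det A) * inverse (det A)) * d i j A"
      have "has_gradient_on ?D g ?e"
        unfolding has_gradient_on_def
      proof (intro allI impI)
        fix \<gamma> t and \<gamma>' :: "'a cmat"
        assume \<gamma>: "has_matrix_derivative \<gamma> \<gamma>' t" "\<gamma> t \<in> ?D"
        have "((\<lambda>s. det (\<gamma> s)) has_field_derivative
            (\<Sum>i\<in>UNIV. \<Sum>j\<in>UNIV. d i j (\<gamma> t) * \<gamma>' $ i $ j)) (at t)"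
          using has_gradient_onD[OF d(2) \<gamma>(1)] by simp
        moreover have "det (\<gamma> t) \<noteq> 0" using \<gamma>(2) by (simp add: invertible_det_nz)
        ultimately have "((\<lambda>s. inverse (det (\<gamma> s))) has_field_derivative
            - (inverse (det (\<gamma> t)) * (\<Sum>i\<in>UNIV. \<Sum>j\<in>UNIV. d i j (\<gamma> t) * \<gamma>' $ i $ j)
              * inverse (det (\<gamma> t)))) (at t)"
          by (rule DERIV_inverse')
        then show "((\<lambda>s. g (\<gamma> s)) has_field_derivative
            (\<Sum>i\<in>UNIV. \<Sum>j\<in>UNIV. ?e i j (\<gamma> t) * \<gamma>' $ i $ j)) (at t)"
          unfolding 2 by (simp add: sum_distrib_left sum_distrib_right sum_negf mult_ac)
      qed
      moreover have "?e i j \<in> function_algebra GL_generators" for i j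
      proof (intro function_algebra.mult function_algebra.const)
        show "d i j \<in> function_algebra GL_generators"
          using d(1)[of i j] polynomial_functions_subset_GL unfolding GL_regular_functions_def by blast
      qed (auto intro: function_algebra.gen)
      ultimately show ?thesis by (intro exI[of _ ?e] conjI allI)
    qed
  qed
  then show ?thesis unfolding GL_regular_functions_def .
qed


section \<open>The Lie algebra of a matrix group\<close>

lemma matrix_mult_linear:
  fixes A B C :: "'n::finite cmat"
  shows "(A + B) ** C = A ** C + B ** C" "A ** (B + C) = A ** B + A ** C"
    "(A - B) ** C = A ** C - B ** C" "A ** (B - C) = A ** B - A ** C"
    "(- A) ** B = - (A ** B)" "A ** (- B) = - (A ** B)"
    "0 ** B = 0" "A ** 0 = 0"
    "cscale c A ** B = cscale c (A ** B)" "A ** cscale c B = cscale c (A ** B)"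
  by (simp_all add: matrix_matrix_mult_def vec_eq_iff cscale_def algebra_simps sum.distrib
      sum_subtractf sum_negf sum_distrib_left)

lemma lie_linear:
  "lie (A + B) C = lie A C + lie B C" "lie A (B + C) = lie A B + lie A C"
  "lie (A - B) C = lie A C - lie B C" "lie A (B - C) = lie A B - lie A C"
  "lie (cscale c A) B = cscale c (lie A B)" "lie A (cscale c B) = cscale c (lie A B)"
  "lie A 0 = 0" "lie 0 A = 0"
  unfolding lie_def
  by (simp_all add: matrix_mult_linear algebra_simps cmat.scale_right_diff_distrib)

lemma group_GL: "group (GL :: 'n::finite cmat monoid)"
proof (rule groupI)
  fix x :: "'n cmat" assume "x \<in> carrier GL"
  then show "\<exists>y\<in>carrier GL. y \<otimes>\<^bsub>GL\<^esub> x = \<one>\<^bsub>GL\<^esub>"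
    unfolding GL_def invertible_def by auto
qed (simp_all add: GL_def matrix_mul_assoc invertible_mult, simp add: invertible_def)

lemma subgroup_GL:
  fixes G :: "'n::finite cmat set"
  assumes "subgroup G GL"
  shows "G \<subseteq> {A. invertible A}" "mat 1 \<in> G"
    "\<And>x y. x \<in> G \<Longrightarrow> y \<in> G \<Longrightarrow> x ** y \<in> G" "\<And>x. x \<in> G \<Longrightarrow> matrix_inv x \<in> G"
proof -
  show 1: "G \<subseteq> {A. invertible A}" using subgroup.subset[OF assms] by (simp add: GL_def)
  show "mat 1 \<in> G" using subgroup.one_closed[OF assms] by (simp add: GL_def)
  show "x ** y \<in> G" if "x \<in> G" "y \<in> G" for x y
    using subgroup.m_closed[OF assms that] by (simp add: GL_def)
  show "matrix_inv x \<in> G" if "x \<in> G" for x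
  proof -
    have x: "x \<in> carrier GL" using that 1 by (auto simp: GL_def)
    then have "x ** inv\<^bsub>GL\<^esub> x = mat 1"
      using group.r_inv[OF group_GL x] by (simp add: GL_def)
    then have "matrix_inv x = inv\<^bsub>GL\<^esub> x" by (rule matrix_inv_eq)
    then show ?thesis using subgroup.m_inv_closed[OF assms that] by simp
  qed
qed

definition vanishing_ideal :: "'n::finite cmat set \<Rightarrow> ('n cmat \<Rightarrow> complex) set" where
  "vanishing_ideal G = {f \<in> GL_regular_functions. \<forall>x\<in>G. f x = 0}"

text \<open>The differentials at the identity of the functions that vanish on \<open>G\<close>. The Lie
  algebra is their common kernel (\<open>Lie_iff_conormal\<close>), which shows that it is a
  linear subspace and turns membership into linear equations that can be checked for families of
  matrices.\<close>

definition conormal :: "'n::finite cmat set \<Rightarrow> ('n \<Rightarrow> 'n \<Rightarrow> complex) set" where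
  "conormal G = {c. \<exists>f\<in>vanishing_ideal G. \<forall>\<gamma> A. has_matrix_derivative \<gamma> A 0 \<longrightarrow> \<gamma> 0 = mat 1 \<longrightarrow>
     ((\<lambda>t. f (\<gamma> t)) has_field_derivative (\<Sum>i\<in>UNIV. \<Sum>j\<in>UNIV. c i j * A $ i $ j)) (at 0)}"

lemma conormal_exists:
  assumes "f \<in> vanishing_ideal G"
  obtains c where "c \<in> conormal G"
    and "\<And>\<gamma> A. has_matrix_derivative \<gamma> A 0 \<Longrightarrow> \<gamma> 0 = mat 1 \<Longrightarrow>
     ((\<lambda>t. f (\<gamma> t)) has_field_derivative (\<Sum>i\<in>UNIV. \<Sum>j\<in>UNIV. c i j * A $ i $ j)) (at 0)"
proof -
  obtain d where d: "has_gradient_on {A. invertible A} f d"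
    using GL_gradient assms unfolding vanishing_ideal_def by blast
  have D: "((\<lambda>t. f (\<gamma> t)) has_field_derivative (\<Sum>i\<in>UNIV. \<Sum>j\<in>UNIV. d i j (mat 1) * A $ i $ j)) (at 0)"
    if "has_matrix_derivative \<gamma> A 0" "\<gamma> 0 = mat 1" for \<gamma> A
    using has_gradient_onD[OF d that(1)] that(2) by (simp add: invertible_det_nz)
  then have "(\<lambda>i j. d i j (mat 1)) \<in> conormal G"
    unfolding conormal_def using assms by blast
  then show ?thesis using that D by blast
qed

lemma Lie_iff_conormal:
  "A \<in> Lie G \<longleftrightarrow> (\<forall>c\<in>conormal G. (\<Sum>i\<in>UNIV. \<Sum>j\<in>UNIV. c i j * A $ i $ j) = 0)"
proof
  assume A: "A \<in> Lie G"
  show "\<forall>c\<in>conormal G. (\<Sum>i\<in>UNIV. \<Sum>j\<in>UNIV. c i j * A $ i $ j) = 0"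
  proof
    fix c assume "c \<in> conormal G"
    then obtain f where f: "f \<in> vanishing_ideal G" and
      "((\<lambda>t. f (mat 1 + cscale t A)) has_field_derivative
         (\<Sum>i\<in>UNIV. \<Sum>j\<in>UNIV. c i j * A $ i $ j)) (at 0)"
      unfolding conormal_def using has_matrix_derivative_line[of "mat 1" A 0] by auto
    moreover have "((\<lambda>t. f (mat 1 + cscale t A)) has_field_derivative 0) (at 0)"
      using A f unfolding Lie_def vanishing_ideal_def by auto
    ultimately show "(\<Sum>i\<in>UNIV. \<Sum>j\<in>UNIV. c i j * A $ i $ j) = 0"
      using DERIV_unique by blast
  qed
next
  assume A: "\<forall>c\<in>conormal G. (\<Sum>i\<in>UNIV. \<Sum>j\<in>UNIV. c i j * A $ i $ j) = 0"
  have "((\<lambda>t. f (mat 1 + cscale t A)) has_field_derivative 0) (at 0)"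
    if f: "f \<in> vanishing_ideal G" for f
  proof -
    obtain c where c: "c \<in> conormal G" and "\<And>\<gamma> A. has_matrix_derivative \<gamma> A 0 \<Longrightarrow> \<gamma> 0 = mat 1 \<Longrightarrow>
        ((\<lambda>t. f (\<gamma> t)) has_field_derivative (\<Sum>i\<in>UNIV. \<Sum>j\<in>UNIV. c i j * A $ i $ j)) (at 0)"
      using conormal_exists[OF f] by blast
    from this(2)[OF has_matrix_derivative_line[of "mat 1" A 0]] A c show ?thesis by simp
  qed
  then show "A \<in> Lie G" unfolding Lie_def vanishing_ideal_def by auto
qed

lemma Lie_subspace: "cmat.subspace (Lie G)" for G :: "'n::finite cmat set"
proof -
  have "(\<Sum>i\<in>UNIV. \<Sum>j\<in>UNIV. c i j * cscale k A $ i $ j) = k * (\<Sum>i\<in>UNIV. \<Sum>j\<in>UNIV. c i j * A $ i $ j)"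
    for c :: "'n \<Rightarrow> 'n \<Rightarrow> complex" and k and A :: "'n cmat"
    by (simp add: sum_distrib_left mult_ac cscale_def)
  then show ?thesis
    by (intro cmat.subspaceI) (simp_all only: Lie_iff_conormal, simp_all add: distrib_left sum.distrib)
qed

lemma Lie_mono: "H \<subseteq> G \<Longrightarrow> Lie H \<subseteq> Lie G"
  unfolding Lie_def by blast

lemma eventually_invertible:
  fixes \<gamma> :: "complex \<Rightarrow> 'n::finite cmat"
  assumes "has_matrix_derivative \<gamma> A t" "invertible (\<gamma> t)"
  shows "eventually (\<lambda>s. invertible (\<gamma> s)) (nhds t)"
proof -
  from polynomial_gradient[OF det_polynomial] obtain d where
    "(\<forall>i j. d i j \<in> polynomial_functions) \<and> has_gradient_on UNIV (det :: 'n cmat \<Rightarrow> complex) d" ..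
  from DERIV_isCont[OF has_gradient_onD[OF conjunct2[OF this] assms(1)]]
  have "isCont (\<lambda>s. det (\<gamma> s)) t" by simp
  then have "((\<lambda>s. det (\<gamma> s)) \<longlongrightarrow> det (\<gamma> t)) (nhds t)"
    unfolding isCont_def by (rule tendsto_at_iff_tendsto_nhds[of "\<lambda>s. det (\<gamma> s)", THEN iffD1])
  from tendsto_imp_eventually_ne[OF this] assms(2)
  show ?thesis by (simp add: invertible_det_nz)
qed

lemma regular_on_agrees_near:
  assumes "regular_on GL_generators {A. invertible A} F"
    and "has_matrix_derivative \<gamma> A t" "invertible (\<gamma> t)"
  shows "\<exists>f\<in>GL_regular_functions. (\<forall>x. invertible x \<longrightarrow> F x = f x) \<and>
    eventually (\<lambda>s. F (\<gamma> s) = f (\<gamma> s)) (nhds t)"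
proof -
  obtain f where f: "f \<in> GL_regular_functions" "\<forall>x. invertible x \<longrightarrow> F x = f x"
    using assms(1) unfolding regular_on_def GL_regular_functions_def by auto
  have "eventually (\<lambda>s. F (\<gamma> s) = f (\<gamma> s)) (nhds t)"
    using eventually_invertible[OF assms(2,3)] by eventually_elim (use f(2) in blast)
  with f show ?thesis by blast
qed

text \<open>The defining property of the tangent space, extended to all curves with the given velocity and
  to functions that are regular only on the invertible matrices.\<close>

lemma Lie_derivative_zero:
  assumes G: "G \<subseteq> {A. invertible A}" and A: "A \<in> Lie G"
    and F: "regular_on GL_generators {A. invertible A} F" "\<And>x. x \<in> G \<Longrightarrow> F x = 0"
    and \<gamma>: "has_matrix_derivative \<gamma> A 0" "\<gamma> 0 = mat 1"
  shows "((\<lambda>t. F (\<gamma> t)) has_field_derivative 0) (at 0)"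
proof -
  have "invertible (\<gamma> 0)" using \<gamma>(2) by (simp add: invertible_det_nz)
  from regular_on_agrees_near[OF F(1) \<gamma>(1) this] obtain f where f: "f \<in> GL_regular_functions"
    and fF: "(\<forall>x. invertible x \<longrightarrow> F x = f x) \<and> eventually (\<lambda>s. F (\<gamma> s) = f (\<gamma> s)) (nhds 0)"
    by (rule bexE)
  have "f x = 0" if "x \<in> G" for x
  proof -
    have "invertible x" using that G by blast
    then show ?thesis using fF F(2)[OF that] by simp
  qed
  with f have f': "f \<in> vanishing_ideal G"
    unfolding vanishing_ideal_def by simp
  obtain c where c: "c \<in> conormal G" and "\<And>\<gamma> A. has_matrix_derivative \<gamma> A 0 \<Longrightarrow> \<gamma> 0 = mat 1 \<Longrightarrow>
      ((\<lambda>t. f (\<gamma> t)) has_field_derivative (\<Sum>i\<in>UNIV. \<Sum>j\<in>UNIV. c i j * A $ i $ j)) (at 0)"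
    using conormal_exists[OF f'] by blast
  from this(2)[OF \<gamma>] have "((\<lambda>t. f (\<gamma> t)) has_field_derivative 0) (at 0)"
    using A c unfolding Lie_iff_conormal by simp
  then show ?thesis using DERIV_cong_ev[OF refl conjunct2[OF fF] refl] by simp
qed

text \<open>If a linear functional kills a family \<open>F x\<close> for all \<open>x \<in> G\<close>, it
  also kills the derivative of \<open>F\<close> in every direction tangent to \<open>G\<close>.
  With \<open>F x = Ad x A\<close> this passes from the adjoint action of the group to the
  bracket.\<close>

lemma Lie_constant_linear:
  assumes G: "G \<subseteq> {A. invertible A}" and B: "B \<in> Lie G"
    and F: "regular_matrix_on GL_generators {A. invertible A} F"
    and const: "\<And>x. x \<in> G \<Longrightarrow> (\<Sum>i\<in>UNIV. \<Sum>j\<in>UNIV. c i j * F x $ i $ j) = 0"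
    and \<gamma>: "has_matrix_derivative \<gamma> B 0" "\<gamma> 0 = mat 1"
    and D: "has_matrix_derivative (\<lambda>t. F (\<gamma> t)) D 0"
  shows "(\<Sum>i\<in>UNIV. \<Sum>j\<in>UNIV. c i j * D $ i $ j) = 0"
proof -
  have "((\<lambda>t. \<Sum>i\<in>UNIV. \<Sum>j\<in>UNIV. c i j * F (\<gamma> t) $ i $ j) has_field_derivative 0) (at 0)"
    using F unfolding regular_matrix_on_def
    by (intro Lie_derivative_zero[OF G B _ const \<gamma>] regular_on_sum regular_on_mult regular_on_const) auto
  moreover have "((\<lambda>t. \<Sum>i\<in>UNIV. \<Sum>j\<in>UNIV. c i j * F (\<gamma> t) $ i $ j) has_field_derivative
      (\<Sum>i\<in>UNIV. \<Sum>j\<in>UNIV. c i j * D $ i $ j)) (at 0)"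
    using D unfolding has_matrix_derivative_def by (auto intro!: derivative_eq_intros simp: mult.commute)
  ultimately show ?thesis using DERIV_unique by blast
qed

lemma regular_Ad:
  "regular_matrix_on GL_generators {A. invertible A} (\<lambda>x. Ad x A)"
  unfolding Ad_def
  by (intro regular_matrix_on_mult regular_matrix_inv regular_matrix_on_const regular_matrix_on_ident) auto

text \<open>The derivative of \<open>x \<mapsto> x\<inverse>\<close> at the identity follows from the
  product rule for \<open>x x\<inverse> = 1\<close>, once Cramer's rule has shown that it
  exists.\<close>

lemma has_matrix_derivative_Ad:
  fixes A B :: "'n::finite cmat"
  shows "has_matrix_derivative (\<lambda>t. Ad (mat 1 + cscale t B) A) (lie B A) 0"
proof -
  let ?\<gamma> = "\<lambda>t. mat 1 + cscale t B"
  have \<gamma>: "has_matrix_derivative ?\<gamma> B 0" by (rule has_matrix_derivative_line)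
  have \<gamma>0: "?\<gamma> 0 = mat 1" by simp
  have inv: "invertible (?\<gamma> 0)" by (simp add: invertible_det_nz)
  have ev: "eventually (\<lambda>t. invertible (?\<gamma> t)) (nhds 0)" by (rule eventually_invertible[OF \<gamma> inv])
  have "((\<lambda>t. matrix_inv (?\<gamma> t) $ i $ j) has_field_derivative
      deriv (\<lambda>t. matrix_inv (?\<gamma> t) $ i $ j) 0) (at 0)" for i j
  proof -
    have "regular_on GL_generators {A. invertible A} (\<lambda>A :: 'n cmat. matrix_inv A $ i $ j)"
      using regular_matrix_inv unfolding regular_matrix_on_def by blast
    from regular_on_agrees_near[OF this \<gamma> inv] obtain f where f: "f \<in> GL_regular_functions"
      and ev: "(\<forall>x. invertible x \<longrightarrow> matrix_inv x $ i $ j = f x) \<and>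
        eventually (\<lambda>s. matrix_inv (?\<gamma> s) $ i $ j = f (?\<gamma> s)) (nhds 0)"
      by (rule bexE)
    from GL_gradient[OF f] obtain d where
      d: "(\<forall>i j. d i j \<in> GL_regular_functions) \<and> has_gradient_on {A. invertible A} f d" ..
    have "((\<lambda>t. f (?\<gamma> t)) has_field_derivative (\<Sum>i\<in>UNIV. \<Sum>j\<in>UNIV. d i j (?\<gamma> 0) * B $ i $ j)) (at 0)"
      using inv by (intro has_gradient_onD[OF conjunct2[OF d] \<gamma>]) simp
    then have d': "((\<lambda>t. matrix_inv (?\<gamma> t) $ i $ j) has_field_derivative
        (\<Sum>i\<in>UNIV. \<Sum>j\<in>UNIV. d i j (?\<gamma> 0) * B $ i $ j)) (at 0)"
      by (rule DERIV_cong_ev[OF refl conjunct2[OF ev] refl, THEN iffD2])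
    show ?thesis unfolding DERIV_imp_deriv[OF d'] by (rule d')
  qed
  note derivs = this
  define D where "D = (\<chi> i j. deriv (\<lambda>t. matrix_inv (?\<gamma> t) $ i $ j) 0)"
  have D: "has_matrix_derivative (\<lambda>t. matrix_inv (?\<gamma> t)) D 0"
    unfolding has_matrix_derivative_def D_def vec_lambda_beta by (intro allI derivs)
  have inv0: "matrix_inv (?\<gamma> 0) = mat 1" by (intro matrix_inv_eq) simp
  have "has_matrix_derivative (\<lambda>t. ?\<gamma> t ** matrix_inv (?\<gamma> t)) (B + D) 0"
    using has_matrix_derivative_mult[OF \<gamma> D] unfolding inv0 by simp
  moreover have "eventually (\<lambda>t. ?\<gamma> t ** matrix_inv (?\<gamma> t) = mat 1) (nhds 0)"
    using ev by eventually_elim (rule matrix_inv_inverse)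
  then have "has_matrix_derivative (\<lambda>t. ?\<gamma> t ** matrix_inv (?\<gamma> t)) 0 0"
    unfolding has_matrix_derivative_def
  proof (intro allI)
    fix i j
    have "eventually (\<lambda>t. (?\<gamma> t ** matrix_inv (?\<gamma> t)) $ i $ j = mat 1 $ i $ j) (nhds 0)"
      using \<open>eventually (\<lambda>t. ?\<gamma> t ** matrix_inv (?\<gamma> t) = mat 1) (nhds 0)\<close>
      by eventually_elim simp
    from DERIV_cong_ev[OF refl this refl]
    show "((\<lambda>t. (?\<gamma> t ** matrix_inv (?\<gamma> t)) $ i $ j) has_field_derivative 0 $ i $ j) (at 0)"
      by simp
  qed
  ultimately have "B + D = 0" by (rule has_matrix_derivative_unique)
  then have "D = - B" by (simp add: eq_neg_iff_add_eq_0 add.commute)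
  then have "has_matrix_derivative (\<lambda>t. matrix_inv (?\<gamma> t)) (- B) 0" using D by simp
  from has_matrix_derivative_mult[OF has_matrix_derivative_mult[OF \<gamma> has_matrix_derivative_const[of A]] this]
  show ?thesis unfolding inv0 Ad_def lie_def by (simp add: matrix_mult_linear)
qed

text \<open>Conjugation by \<open>x\<close> is a regular map that preserves \<open>G\<close> and fixes the
  identity; \<open>Ad x\<close> is its differential.\<close>

lemma Ad_Lie:
  fixes G :: "'n::finite cmat set"
  assumes G: "subgroup G GL" and x: "x \<in> G" and A: "A \<in> Lie G"
  shows "Ad x A \<in> Lie G"
  unfolding Lie_iff_conormal
proof
  fix c assume "c \<in> conormal G"
  then obtain f where f: "f \<in> vanishing_ideal G" and
    D: "\<And>\<gamma> A. has_matrix_derivative \<gamma> A 0 \<Longrightarrow> \<gamma> 0 = mat 1 \<Longrightarrow>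
     ((\<lambda>t. f (\<gamma> t)) has_field_derivative (\<Sum>i\<in>UNIV. \<Sum>j\<in>UNIV. c i j * A $ i $ j)) (at 0)"
    unfolding conormal_def by blast
  note G' = subgroup_GL[OF G]
  have xi: "x ** matrix_inv x = mat 1" "matrix_inv x ** x = mat 1"
    using matrix_inv_inverse[of x] G'(1) x by auto
  let ?F = "\<lambda>y. x ** y ** matrix_inv x"
  have cancel: "M ** matrix_inv x ** x = M" for M :: "'n cmat"
    using xi by (metis matrix_mul_assoc matrix_mul_rid)
  have "regular_on GL_generators {A. invertible A} (\<lambda>y. f (?F y))"
  proof (rule regular_on_compose_invertible)
    show "f \<in> GL_regular_functions" using f by (simp add: vanishing_ideal_def)
    show "regular_matrix_on GL_generators {A. invertible A} ?F"
      by (intro regular_matrix_on_mult regular_matrix_on_const regular_matrix_on_ident) auto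
    show "regular_matrix_on GL_generators {A. invertible A} (\<lambda>y. x ** matrix_inv y ** matrix_inv x)"
      by (intro regular_matrix_on_mult regular_matrix_on_const regular_matrix_inv)
    show "?F y ** (x ** matrix_inv y ** matrix_inv x) = mat 1" if "y \<in> {A. invertible A}" for y
    proof -
      have "?F y ** (x ** matrix_inv y ** matrix_inv x) = x ** (y ** matrix_inv y) ** matrix_inv x"
        by (simp add: matrix_mul_assoc cancel)
      then show ?thesis using that xi by (simp add: matrix_inv_inverse)
    qed
  qed
  moreover have "f (?F y) = 0" if "y \<in> G" for y
    using f G'(3,4) x that unfolding vanishing_ideal_def by simp
  moreover have \<gamma>: "has_matrix_derivative (\<lambda>t. mat 1 + cscale t A) A 0" by (rule has_matrix_derivative_line)
  ultimately have "((\<lambda>t. f (?F (mat 1 + cscale t A))) has_field_derivative 0) (at 0)"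
    using Lie_derivative_zero[OF G'(1) A, of "\<lambda>y. f (?F y)"] by simp
  moreover have "((\<lambda>t. f (?F (mat 1 + cscale t A))) has_field_derivative
      (\<Sum>i\<in>UNIV. \<Sum>j\<in>UNIV. c i j * Ad x A $ i $ j)) (at 0)"
  proof (rule D)
    show "has_matrix_derivative (\<lambda>t. ?F (mat 1 + cscale t A)) (Ad x A) 0"
      using has_matrix_derivative_mult[OF has_matrix_derivative_mult[OF has_matrix_derivative_const[of x] \<gamma>]
          has_matrix_derivative_const[of "matrix_inv x"]]
      by (simp add: Ad_def matrix_mult_linear)
  qed (simp add: xi)
  ultimately show "(\<Sum>i\<in>UNIV. \<Sum>j\<in>UNIV. c i j * Ad x A $ i $ j) = 0"
    using DERIV_unique by blast
qed

lemma lie_Lie: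
  fixes G :: "'n::finite cmat set"
  assumes G: "subgroup G GL" and A: "A \<in> Lie G" and B: "B \<in> Lie G"
  shows "lie A B \<in> Lie G"
  unfolding Lie_iff_conormal
proof
  fix c assume c: "c \<in> conormal G"
  show "(\<Sum>i\<in>UNIV. \<Sum>j\<in>UNIV. c i j * lie A B $ i $ j) = 0"
  proof (rule Lie_constant_linear[OF subgroup_GL(1)[OF G] A regular_Ad[of B],
        where \<gamma> = "\<lambda>t. mat 1 + cscale t A"])
    show "(\<Sum>i\<in>UNIV. \<Sum>j\<in>UNIV. c i j * Ad x B $ i $ j) = 0" if "x \<in> G" for x
      using Ad_Lie[OF G that B] c unfolding Lie_iff_conormal by blast
    show "has_matrix_derivative (\<lambda>t. Ad (mat 1 + cscale t A) B) (lie A B) 0"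
      by (rule has_matrix_derivative_Ad)
  qed (simp_all add: has_matrix_derivative_line)
qed

text \<open>Differentiate \<open>x y - y x = 0\<close> in each variable separately.\<close>

lemma Lie_commutative:
  fixes H :: "'n::finite cmat set"
  assumes H: "H \<subseteq> {A. invertible A}" and comm: "\<And>x y. x \<in> H \<Longrightarrow> y \<in> H \<Longrightarrow> x ** y = y ** x"
    and A: "A \<in> Lie H" and B: "B \<in> Lie H"
  shows "lie A B = 0"
proof -
  have vanish: "lie A M = 0"
    if A: "A \<in> Lie H" and M: "\<And>x. x \<in> H \<Longrightarrow> lie x M = 0" for A M
  proof -
    have "lie A M $ k $ l = 0" for k l
    proof -
      have "((\<lambda>t. lie (mat 1 + cscale t A) M $ k $ l) has_field_derivative 0) (at 0)"
      proof (rule Lie_derivative_zero[OF H A, where F = "\<lambda>x. lie x M $ k $ l"])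
        have "regular_matrix_on GL_generators {A. invertible A} (\<lambda>x. lie x M)"
          unfolding lie_def
          by (intro regular_matrix_on_diff regular_matrix_on_mult regular_matrix_on_const
              regular_matrix_on_ident) auto
        then show "regular_on GL_generators {A. invertible A} (\<lambda>x. lie x M $ k $ l)"
          unfolding regular_matrix_on_def by blast
      qed (simp_all add: M has_matrix_derivative_line)
      moreover have "lie (mat 1 + cscale t A) M $ k $ l = t * lie A M $ k $ l" for t
        by (simp add: lie_linear) (simp add: lie_def cscale_def)
      ultimately have "((\<lambda>t. t * lie A M $ k $ l) has_field_derivative 0) (at 0)" by simp
      moreover have "((\<lambda>t. t * lie A M $ k $ l) has_field_derivative lie A M $ k $ l) (at 0)"
        by (auto intro!: derivative_eq_intros)
      ultimately show ?thesis using DERIV_unique by blast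
    qed
    then show ?thesis by (simp add: vec_eq_iff)
  qed
  have "lie x B = 0" if "x \<in> H" for x
  proof -
    have "lie B x = 0" using comm that by (intro vanish[OF B]) (simp add: lie_def)
    then show ?thesis by (simp add: lie_def)
  qed
  then show ?thesis by (rule vanish[OF A])
qed

lemma torus_commutative:
  assumes T: "torus T" and "x \<in> T" "y \<in> T"
  shows "x ** y = y ** x"
proof -
  obtain k \<phi> \<psi> where \<phi>: "\<phi> \<in> hom (Gm_power k) (grp T)"
    and iso: "inverse_isomorphisms (Gm_power_variety k) (group_variety T) \<phi> \<psi>"
    using T unfolding torus_def by blast
  have \<psi>: "\<psi> z \<in> carrier (Gm_power k)" "\<phi> (\<psi> z) = z" if "z \<in> T" for z
    using iso that unfolding inverse_isomorphisms_def morphism_def Gm_power_variety_def group_variety_def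
    by auto
  have mult: "\<phi> (a \<otimes>\<^bsub>Gm_power k\<^esub> b) = \<phi> a ** \<phi> b"
    if "a \<in> carrier (Gm_power k)" "b \<in> carrier (Gm_power k)" for a b
    using hom_mult[OF \<phi> that] by (simp add: GL_def)
  have "a \<otimes>\<^bsub>Gm_power k\<^esub> b = b \<otimes>\<^bsub>Gm_power k\<^esub> a" for a b
    unfolding Gm_power_def product_group_def Gm_def by (auto simp: mult.commute)
  then show ?thesis using mult \<psi> assms(2,3) by metis
qed

text \<open>Differentiate \<open>f (Ad x A) = f A\<close> at \<open>x = 1\<close> in the direction
  \<open>B\<close>: the differential of \<open>f\<close> at \<open>A\<close> kills \<open>[B,
  A]\<close>.\<close>

lemma invariant_polynomial_infinitesimal:
  fixes G :: "'n::finite cmat set"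
  assumes G: "subgroup G GL" and f: "f \<in> invariant_polynomials G" and d: "has_gradient_on UNIV f d"
    and A: "A \<in> Lie G" and B: "B \<in> Lie G"
  shows "(\<Sum>i\<in>UNIV. \<Sum>j\<in>UNIV. d i j A * lie B A $ i $ j) = 0"
proof -
  have f': "f \<in> polynomial_functions" "\<And>x A. x \<in> G \<Longrightarrow> A \<in> Lie G \<Longrightarrow> f (Ad x A) = f A"
    using f unfolding invariant_polynomials_def by auto
  have "((\<lambda>t. f (Ad (mat 1 + cscale t B) A) - f A) has_field_derivative 0) (at 0)"
  proof (rule Lie_derivative_zero[OF subgroup_GL(1)[OF G] B, where F = "\<lambda>x. f (Ad x A) - f A"])
    show "regular_on GL_generators {A. invertible A} (\<lambda>x. f (Ad x A) - f A)"
      by (intro regular_on_diff regular_on_const regular_on_compose_polynomial[OF f'(1)] regular_Ad)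
  qed (simp_all add: f' A has_matrix_derivative_line)
  moreover have "Ad (mat 1) A = A" unfolding Ad_def by (simp add: matrix_inv_eq[of "mat 1" "mat 1"])
  then have "((\<lambda>t. f (Ad (mat 1 + cscale t B) A) - f A) has_field_derivative
      (\<Sum>i\<in>UNIV. \<Sum>j\<in>UNIV. d i j A * lie B A $ i $ j)) (at 0)"
    using DERIV_diff[OF has_gradient_onD[OF d has_matrix_derivative_Ad[of B A]] DERIV_const[of "f A"]]
    by simp
  ultimately show ?thesis using DERIV_unique by blast
qed


section \<open>Exponentials of nilpotent matrices\<close>

primrec matrix_power :: "'n::finite cmat \<Rightarrow> nat \<Rightarrow> 'n cmat" where
  "matrix_power A 0 = mat 1"
| "matrix_power A (Suc k) = A ** matrix_power A k"

lemma matrix_power_cscale: "matrix_power (cscale t A) k = cscale (t ^ k) (matrix_power A k)"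
  by (induction k) (simp_all add: matrix_mult_linear)

lemma matrix_power_commute: "matrix_power A k ** A = A ** matrix_power A k"
  by (induction k) (simp_all add: matrix_mul_assoc [symmetric])

lemma regular_matrix_power:
  "regular_matrix_on S D F \<Longrightarrow> regular_matrix_on S D (\<lambda>x. matrix_power (F x) k)"
  by (induction k) (simp_all add: regular_matrix_on_const regular_matrix_on_mult)

text \<open>The exponential series cut off after \<open>m\<close> terms, which is the exponential of
  \<open>A\<close> whenever \<open>A\<^sup>m = 0\<close>. It is polynomial in \<open>A\<close>,
  with the same formula for all such matrices.\<close>

definition exp_truncated :: "nat \<Rightarrow> 'n::finite cmat \<Rightarrow> 'n cmat" where
  "exp_truncated m A = (\<Sum>k<m. cscale (1 / fact k) (matrix_power A k))"

lemma regular_exp_truncated: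
  "regular_matrix_on S D F \<Longrightarrow> regular_matrix_on S D (\<lambda>x. exp_truncated m (F x))"
  unfolding exp_truncated_def
  by (intro regular_matrix_on_sum regular_matrix_on_cscale regular_on_const regular_matrix_power)

lemma exp_truncated_commute: "exp_truncated m A ** A = A ** exp_truncated m A"
proof -
  have sum_l: "(\<Sum>k\<in>I. f k) ** A = (\<Sum>k\<in>I. f k ** A)" and sum_r: "A ** (\<Sum>k\<in>I. f k) = (\<Sum>k\<in>I. A ** f k)"
    for f :: "nat \<Rightarrow> 'a cmat" and I
    by (induction I rule: infinite_finite_induct) (simp_all add: matrix_mult_linear)
  show ?thesis unfolding exp_truncated_def
    by (simp add: sum_l sum_r matrix_mult_linear matrix_power_commute)
qed

lemma exp_truncated_0: "0 < m \<Longrightarrow> exp_truncated m 0 = mat 1"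
  by (cases m) (simp_all add: exp_truncated_def lessThan_Suc_eq_insert_0 sum.reindex matrix_mult_linear)

text \<open>Differentiation shifts the terms by one place; the term lost at the top contains
  \<open>A\<^sup>m\<close>.\<close>

lemma exp_truncated_derivative:
  fixes A :: "'n::finite cmat"
  assumes nil: "matrix_power A m = 0"
  shows "has_matrix_derivative (\<lambda>t. exp_truncated m (cscale t A)) (A ** exp_truncated m (cscale t A)) t"
proof (cases m)
  case 0
  then have "exp_truncated m (cscale s A) = 0" for s by (simp add: exp_truncated_def)
  then show ?thesis by (simp add: has_matrix_derivative_const matrix_mult_linear)
next
  case (Suc l)
  have term_derivative: "has_matrix_derivative (\<lambda>t. cscale (1 / fact k) (matrix_power (cscale t A) k))
      (cscale (of_nat k * t ^ (k - 1) / fact k) (matrix_power A k)) t" for k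
    unfolding matrix_power_cscale cmat.scale_scale
    by (rule has_matrix_derivative_cscale) (auto intro!: derivative_eq_intros)
  have sum_r: "A ** (\<Sum>k\<in>I. f k) = (\<Sum>k\<in>I. A ** f k)" for f :: "nat \<Rightarrow> 'n cmat" and I
    by (induction I rule: infinite_finite_induct) (simp_all add: matrix_mult_linear)
  have "(\<Sum>k<m. cscale (of_nat k * t ^ (k - 1) / fact k) (matrix_power A k))
      = (\<Sum>k<l. cscale (of_nat (Suc k) * t ^ k / fact (Suc k)) (matrix_power A (Suc k)))"
    unfolding Suc sum.lessThan_Suc_shift by simp
  also have "\<dots> = (\<Sum>k<l. cscale (t ^ k / fact k) (matrix_power A (Suc k)))"
    by (intro sum.cong refl arg_cong2[where f = cscale]) (simp del: of_nat_Suc)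
  also have "\<dots> = (\<Sum>k<m. cscale (t ^ k / fact k) (matrix_power A (Suc k)))"
    unfolding Suc sum.lessThan_Suc using nil Suc by simp
  also have "\<dots> = A ** exp_truncated m (cscale t A)"
    unfolding exp_truncated_def sum_r
    by (intro sum.cong refl) (simp add: matrix_mult_linear matrix_power_cscale)
  finally have "(\<Sum>k<m. cscale (of_nat k * t ^ (k - 1) / fact k) (matrix_power A k))
      = A ** exp_truncated m (cscale t A)" .
  moreover have "has_matrix_derivative (\<lambda>t. exp_truncated m (cscale t A))
      (\<Sum>k<m. cscale (of_nat k * t ^ (k - 1) / fact k) (matrix_power A k)) t"
    unfolding exp_truncated_def by (rule has_matrix_derivative_sum) (rule term_derivative)
  ultimately show ?thesis by simp
qed

lemma has_matrix_derivative_zero_constant: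
  assumes "\<And>t. has_matrix_derivative \<gamma> 0 t"
  shows "\<gamma> s = \<gamma> t"
proof -
  have "\<gamma> s $ i $ j = \<gamma> t $ i $ j" for i j
  proof -
    have "\<exists>c. \<forall>s\<in>UNIV. \<gamma> s $ i $ j = c"
      using assms unfolding has_matrix_derivative_def
      by (intro has_field_derivative_zero_constant) auto
    then show ?thesis by auto
  qed
  then show ?thesis by (simp add: vec_eq_iff)
qed

lemma has_matrix_derivative_compose_uminus:
  assumes "has_matrix_derivative \<gamma> A (- t)"
  shows "has_matrix_derivative (\<lambda>s. \<gamma> (- s)) (- A) t"
  unfolding has_matrix_derivative_def
proof (intro allI)
  fix i j
  have "((\<lambda>s. \<gamma> s $ i $ j) has_field_derivative A $ i $ j) (at (- t))"
    using assms unfolding has_matrix_derivative_def by blast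
  then have "((\<lambda>s. \<gamma> (- s) $ i $ j) has_field_derivative A $ i $ j * (- 1)) (at t)"
    by (rule DERIV_chain2[where g = uminus]) (auto intro!: derivative_eq_intros)
  then show "((\<lambda>s. \<gamma> (- s) $ i $ j) has_field_derivative (- A) $ i $ j) (at t)" by simp
qed

text \<open>The derivative of \<open>t \<mapsto> exp (t A) exp (- t A)\<close> vanishes.\<close>

lemma exp_truncated_inverse:
  fixes A :: "'n::finite cmat"
  assumes nil: "matrix_power A m = 0"
  shows "exp_truncated m (cscale t A) ** exp_truncated m (cscale (- t) A) = mat 1"
proof (cases m)
  case 0
  then have "(mat 1 :: 'n cmat) = 0" using nil by simp
  then have "M = N" for M N :: "'n cmat"
    by (metis matrix_mul_lid matrix_mult_linear(7))
  then show ?thesis by blast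
next
  case (Suc l)
  define E where "E t = exp_truncated m (cscale t A)" for t
  have E: "has_matrix_derivative E (A ** E t) t" for t
    unfolding E_def by (rule exp_truncated_derivative[OF nil])
  have comm: "E t ** A = A ** E t" for t
  proof (cases "t = 0")
    case True
    then show ?thesis unfolding E_def using Suc by (simp add: exp_truncated_0)
  next
    case False
    have "cscale t (E t ** A) = cscale t (A ** E t)"
      using exp_truncated_commute[of m "cscale t A"] unfolding E_def by (simp add: matrix_mult_linear)
    then show ?thesis using False by simp
  qed
  have "has_matrix_derivative (\<lambda>s. E s ** E (- s)) 0 s" for s
    using has_matrix_derivative_mult[OF E[of s] has_matrix_derivative_compose_uminus[OF E[of "- s"]]]
    by (simp add: matrix_mult_linear matrix_mul_assoc comm)
  then have "E t ** E (- t) = E 0 ** E (- 0)" by (rule has_matrix_derivative_zero_constant)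
  also have "\<dots> = mat 1" unfolding E_def using Suc by (simp add: exp_truncated_0)
  finally show ?thesis unfolding E_def .
qed

lemma regular_on_complex_poly:
  assumes "regular_on {\<lambda>t. t} UNIV f"
  shows "\<exists>p. f = poly p"
proof -
  have "\<exists>p. r = poly p" if "r \<in> function_algebra {\<lambda>t :: complex. t}" for r
    using that
  proof induction
    case (gen f)
    have "(\<lambda>t. t) = poly [:0, 1 :: complex:]" by auto
    then show ?case using gen by blast
  next
    case (const c)
    have "(\<lambda>_. c) = poly [:c:]" by auto
    then show ?case by blast
  next
    case (add f g)
    then show ?case by (metis poly_add)
  next
    case (mult f g)
    then show ?case by (metis poly_mult)
  qed
  moreover obtain r where "r \<in> function_algebra {\<lambda>t. t}" "f = r"
    using assms unfolding regular_on_def by blast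
  ultimately show ?thesis by blast
qed

text \<open>For \<open>A\<close> tangent to \<open>G\<close>, the derivative of \<open>f\<close> along the
  left invariant vector field \<open>x \<mapsto> x A\<close> is a regular function
  \<open>g\<close>, and it vanishes on \<open>G\<close> together with \<open>f\<close>, since
  \<open>y \<mapsto> f (x y)\<close> vanishes on \<open>G\<close> for every \<open>x \<in>
  G\<close>. So the vanishing ideal is stable under this derivation.\<close>

lemma vanishing_ideal_derivation:
  fixes G :: "'n::finite cmat set"
  assumes G: "subgroup G GL" and A: "A \<in> Lie G" and f: "f \<in> vanishing_ideal G"
  shows "\<exists>g\<in>vanishing_ideal G. \<forall>\<gamma> t. has_matrix_derivative \<gamma> (\<gamma> t ** A) t \<longrightarrow> invertible (\<gamma> t) \<longrightarrow>
    ((\<lambda>s. f (\<gamma> s)) has_field_derivative g (\<gamma> t)) (at t)"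
proof -
  note G' = subgroup_GL[OF G]
  have f_reg: "f \<in> GL_regular_functions" using f by (simp add: vanishing_ideal_def)
  from GL_gradient[OF this] obtain d where
    "(\<forall>i j. d i j \<in> GL_regular_functions) \<and> has_gradient_on {A. invertible A} f d" ..
  then have d: "\<And>i j. d i j \<in> GL_regular_functions" "has_gradient_on {A. invertible A} f d" by auto
  have "regular_on GL_generators UNIV (\<lambda>x. \<Sum>i\<in>UNIV. \<Sum>j\<in>UNIV. d i j x * (x ** A) $ i $ j)"
  proof (intro regular_on_sum regular_on_mult)
    show "regular_on GL_generators UNIV (d i j)" for i j
      using d(1) unfolding GL_regular_functions_def by (rule regular_on_function_algebra)
    have "regular_matrix_on GL_generators UNIV (\<lambda>x. x ** A)"
      by (intro regular_matrix_on_mult regular_matrix_on_const regular_matrix_on_ident) auto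
    then show "regular_on GL_generators UNIV (\<lambda>x. (x ** A) $ i $ j)" for i j
      unfolding regular_matrix_on_def by blast
  qed
  then obtain g where g: "g \<in> GL_regular_functions"
      and g_eq: "\<And>x. (\<Sum>i\<in>UNIV. \<Sum>j\<in>UNIV. d i j x * (x ** A) $ i $ j) = g x"
    unfolding regular_on_def GL_regular_functions_def by auto
  have D: "((\<lambda>s. f (\<gamma> s)) has_field_derivative g (\<gamma> t)) (at t)"
    if "has_matrix_derivative \<gamma> (\<gamma> t ** A) t" "invertible (\<gamma> t)" for \<gamma> t
    using has_gradient_onD[OF d(2) that(1)] that(2) by (simp add: g_eq)
  have "g x = 0" if x: "x \<in> G" for x
  proof -
    have \<gamma>: "has_matrix_derivative (\<lambda>t. mat 1 + cscale t A) A 0" by (rule has_matrix_derivative_line)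
    have xi: "x ** matrix_inv x = mat 1" "invertible x"
      using matrix_inv_inverse[of x] G'(1) x by auto
    have "((\<lambda>t. f (x ** (mat 1 + cscale t A))) has_field_derivative 0) (at 0)"
    proof (rule Lie_derivative_zero[OF G'(1) A _ _ \<gamma>, where F = "\<lambda>y. f (x ** y)"])
      show "regular_on GL_generators {A. invertible A} (\<lambda>y. f (x ** y))"
      proof (rule regular_on_compose_invertible[OF f_reg])
        show "regular_matrix_on GL_generators {A. invertible A} (\<lambda>y. x ** y)"
          by (intro regular_matrix_on_mult regular_matrix_on_const regular_matrix_on_ident) auto
        show "regular_matrix_on GL_generators {A. invertible A} (\<lambda>y. matrix_inv y ** matrix_inv x)"
          by (intro regular_matrix_on_mult regular_matrix_on_const regular_matrix_inv)
        show "x ** y ** (matrix_inv y ** matrix_inv x) = mat 1" if "y \<in> {A. invertible A}" for y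
        proof -
          have "x ** y ** (matrix_inv y ** matrix_inv x) = x ** (y ** matrix_inv y) ** matrix_inv x"
            by (simp add: matrix_mul_assoc)
          then show ?thesis using that xi by (simp add: matrix_inv_inverse)
        qed
      qed
      show "f (x ** y) = 0" if "y \<in> G" for y
        using f G'(3)[OF x that] by (simp add: vanishing_ideal_def)
    qed simp
    moreover have "((\<lambda>t. f (x ** (mat 1 + cscale t A))) has_field_derivative g (x ** (mat 1 + cscale 0 A))) (at 0)"
    proof (rule D)
      show "has_matrix_derivative (\<lambda>t. x ** (mat 1 + cscale t A)) (x ** (mat 1 + cscale 0 A) ** A) 0"
        using has_matrix_derivative_mult[OF has_matrix_derivative_const[of x] \<gamma>]
        by (simp add: matrix_mult_linear)
    qed (simp add: xi)
    ultimately have "g (x ** (mat 1 + cscale 0 A)) = 0" using DERIV_unique by blast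
    then show ?thesis by simp
  qed
  with g have "g \<in> vanishing_ideal G" by (simp add: vanishing_ideal_def)
  with D show ?thesis by (intro bexI[of _ g]) auto
qed

text \<open>The curve \<open>t \<mapsto> exp (t A)\<close> is an integral curve of the vector field \<open>x
  \<mapsto> x A\<close>. If \<open>f\<close> vanishes on \<open>G\<close>, the polynomial
  \<open>p t = f (exp (t A))\<close> vanishes at \<open>0\<close>, and its derivative is of the
  same form for another function of the vanishing ideal. By induction on the degree \<open>p =
  0\<close>. As \<open>G\<close> is closed, this puts \<open>exp A\<close> into
  \<open>G\<close>.\<close>

lemma exp_truncated_in_group:
  fixes G :: "'n::finite cmat set"
  assumes G: "linear_algebraic_group G" and A: "A \<in> Lie G" and nil: "matrix_power A m = 0"
  shows "exp_truncated m A \<in> G"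
proof -
  have sub: "subgroup G GL" and closed: "zariski_closed G"
    using G unfolding linear_algebraic_group_def by auto
  note G' = subgroup_GL[OF sub]
  define E where "E t = exp_truncated m (cscale t A)" for t
  have E_inverse: "E t ** E (- t) = mat 1" for t
    unfolding E_def by (rule exp_truncated_inverse[OF nil])
  then have E_invertible: "invertible (E t)" for t
    using matrix_left_right_inverse[of "E t" "E (- t)"] unfolding invertible_def by blast
  have E0: "E 0 = mat 1"
  proof (cases m)
    case 0
    then have "(mat 1 :: 'n cmat) = 0" using nil by simp
    then show ?thesis by (metis matrix_mul_lid matrix_mult_linear(7))
  qed (simp add: E_def exp_truncated_0)
  have E_derivative: "has_matrix_derivative E (E t ** A) t" for t
  proof (cases "t = 0")
    case True
    show ?thesis
      using exp_truncated_derivative[OF nil, of t] E0 unfolding E_def[symmetric] True by simp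
  next
    case False
    have "cscale t (E t ** A) = cscale t (A ** E t)"
      using exp_truncated_commute[of m "cscale t A"] unfolding E_def by (simp add: matrix_mult_linear)
    then have "E t ** A = A ** E t" using False by simp
    then show ?thesis
      using exp_truncated_derivative[OF nil, of t] unfolding E_def[symmetric] by simp
  qed
  have regular_scale: "regular_matrix_on {\<lambda>t. t} UNIV (\<lambda>t. cscale (c * t) A)" for c
    by (intro regular_matrix_on_cscale regular_matrix_on_const regular_on_mult regular_on_const
        regular_on_function_algebra function_algebra.gen) simp
  have E_regular: "regular_matrix_on {\<lambda>t. t} UNIV E"
    using regular_exp_truncated[OF regular_scale[of 1]] unfolding E_def by simp
  have E_regular': "regular_matrix_on {\<lambda>t. t} UNIV (\<lambda>t. E (- t))"
    using regular_exp_truncated[OF regular_scale[of "- 1"]] unfolding E_def by simp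
  have zero: "p = 0" if "f \<in> vanishing_ideal G" "(\<lambda>t. f (E t)) = poly p" for f p
    using that
  proof (induction "degree p" arbitrary: p f rule: less_induct)
    case less
    from vanishing_ideal_derivation[OF sub A less.prems(1)] obtain g where
      g: "g \<in> vanishing_ideal G" and
      "\<forall>\<gamma> t. has_matrix_derivative \<gamma> (\<gamma> t ** A) t \<longrightarrow> invertible (\<gamma> t) \<longrightarrow>
        ((\<lambda>s. f (\<gamma> s)) has_field_derivative g (\<gamma> t)) (at t)" ..
    then have "((\<lambda>s. f (E s)) has_field_derivative g (E t)) (at t)" for t
      using E_derivative E_invertible by blast
    then have "(poly p has_field_derivative g (E t)) (at t)" for t
      unfolding less.prems(2) .
    then have gE: "(\<lambda>t. g (E t)) = poly (pderiv p)"
      using poly_DERIV DERIV_unique by blast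
    have "pderiv p = 0"
    proof (cases "degree p = 0")
      case True
      then show ?thesis by (simp add: pderiv_eq_0_iff)
    next
      case False
      then show ?thesis
        using less.hyps[OF _ g gE] by (simp add: degree_pderiv)
    qed
    then obtain c where c: "p = [:c:]"
      by (metis degree_eq_zeroE pderiv_eq_0_iff)
    have "poly p 0 = 0"
      using fun_cong[OF less.prems(2), of 0] less.prems(1) E0 G'(2) by (simp add: vanishing_ideal_def)
    then show ?case using c by simp
  qed
  have "f (E 1) = 0" if f: "f \<in> vanishing_ideal G" for f
  proof -
    have "f \<in> GL_regular_functions" using f by (simp add: vanishing_ideal_def)
    from regular_on_compose_invertible[OF this E_regular E_regular' E_inverse]
    have "regular_on {\<lambda>t. t} UNIV (\<lambda>t. f (E t))" .
    then obtain p where p: "(\<lambda>t. f (E t)) = poly p" using regular_on_complex_poly by blast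
    from zero[OF f p] fun_cong[OF p, of 1] show ?thesis by simp
  qed
  moreover obtain F where "F \<subseteq> GL_regular_functions" "G = {A. invertible A \<and> (\<forall>f\<in>F. f A = 0)}"
    using closed unfolding zariski_closed_def by blast
  ultimately have "E 1 \<in> G" using E_invertible unfolding vanishing_ideal_def by auto
  then show ?thesis unfolding E_def by simp
qed


section \<open>Polynomials in linear operators and weight spaces\<close>

abbreviation cmat_linear :: "('n::finite cmat \<Rightarrow> 'n cmat) \<Rightarrow> bool" where
  "cmat_linear T \<equiv> Vector_Spaces.linear cscale cscale T"

lemma cmat_linearI:
  assumes "\<And>A B. T (A + B) = T A + T B" "\<And>c A. T (cscale c A) = cscale c (T A)"
  shows "cmat_linear T"
  unfolding Vector_Spaces.linear_iff using assms by (simp add: cmat.vector_space_axioms)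

lemma cmat_linear_simps:
  assumes "cmat_linear T"
  shows "T (A + B) = T A + T B" "T (cscale c A) = cscale c (T A)" "T 0 = 0" "T (A - B) = T A - T B"
    "T (\<Sum>i\<in>I. F i) = (\<Sum>i\<in>I. T (F i))"
proof -
  interpret T: Vector_Spaces.linear cscale cscale T by (rule assms)
  show "T (A + B) = T A + T B" "T (cscale c A) = cscale c (T A)" "T 0 = 0" "T (A - B) = T A - T B"
    "T (\<Sum>i\<in>I. F i) = (\<Sum>i\<in>I. T (F i))"
    by (rule T.add T.scale T.zero T.diff T.sum)+
qed

lemma cmat_linear_lie: "cmat_linear (lie A)"
  by (rule cmat_linearI) (simp_all add: lie_linear)

definition matrix_unit :: "'n::finite \<Rightarrow> 'n \<Rightarrow> 'n cmat" where
  "matrix_unit k l = (\<chi> i j. if i = k \<and> j = l then 1 else 0)"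

lemma matrix_unit_expansion:
  "A = (\<Sum>k\<in>UNIV. \<Sum>l\<in>UNIV. cscale (A $ k $ l) (matrix_unit k l))" for A :: "'n::finite cmat"
proof -
  have "(\<Sum>k\<in>UNIV. \<Sum>l\<in>UNIV. cscale (A $ k $ l) (matrix_unit k l)) $ i $ j = A $ i $ j" for i j
  proof -
    have "(\<Sum>k\<in>UNIV. \<Sum>l\<in>UNIV. cscale (A $ k $ l) (matrix_unit k l)) $ i $ j
        = (\<Sum>k\<in>UNIV. \<Sum>l\<in>UNIV. A $ k $ l * (if i = k \<and> j = l then 1 else 0))"
      by (simp add: cscale_def matrix_unit_def)
    also have "\<dots> = (\<Sum>k\<in>UNIV. if i = k then (\<Sum>l\<in>UNIV. if j = l then A $ k $ l else 0) else 0)"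
      by (intro sum.cong refl) (simp add: if_distrib[of "\<lambda>c. _ * c"] cong: if_cong)
    also have "\<dots> = A $ i $ j" by simp
    finally show ?thesis .
  qed
  then show ?thesis by (simp add: vec_eq_iff)
qed

lemma span_matrix_units: "cmat.span (range (\<lambda>(k, l). matrix_unit k l)) = UNIV"
proof -
  have "A \<in> cmat.span (range (\<lambda>(k, l). matrix_unit k l))" for A :: "'a cmat"
    by (subst matrix_unit_expansion)
      (intro cmat.span_sum cmat.span_scale cmat.span_base, auto)
  then show ?thesis by blast
qed

lemma regular_matrix_on_linear:
  assumes T: "cmat_linear T" and F: "regular_matrix_on S D F"
  shows "regular_matrix_on S D (\<lambda>x. T (F x))"
proof -
  have "T A = (\<Sum>k\<in>UNIV. \<Sum>l\<in>UNIV. cscale (A $ k $ l) (T (matrix_unit k l)))" for A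
    by (subst matrix_unit_expansion[of A]) (simp add: cmat_linear_simps[OF T])
  then have eq: "T (F x) = (\<Sum>k\<in>UNIV. \<Sum>l\<in>UNIV. cscale (F x $ k $ l) (T (matrix_unit k l)))" for x
    by blast
  show ?thesis
    unfolding eq using F
    by (intro regular_matrix_on_sum regular_matrix_on_cscale regular_matrix_on_const)
      (simp add: regular_matrix_on_def)
qed

text \<open>A linear relation that is total on \<open>W\<close> contains the graph of a linear map over
  \<open>W\<close>: choose values on a basis. This makes the conjugating elements depend
  polynomially on the point.\<close>

lemma linear_choice:
  fixes R :: "'n::finite cmat \<Rightarrow> 'n cmat \<Rightarrow> bool"
  assumes "\<And>A. A \<in> W \<Longrightarrow> \<exists>B. R A B"
    and add: "\<And>A A' B B'. R A B \<Longrightarrow> R A' B' \<Longrightarrow> R (A + A') (B + B')"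
    and scale: "\<And>c A B. R A B \<Longrightarrow> R (cscale c A) (cscale c B)" and zero: "R 0 0"
  shows "\<exists>\<nu>. cmat_linear \<nu> \<and> (\<forall>A\<in>W. R A (\<nu> A))"
proof -
  obtain f where f: "\<And>A. A \<in> W \<Longrightarrow> R A (f A)" using assms(1) by metis
  obtain B where B: "B \<subseteq> W" "cmat.independent B" "W \<subseteq> cmat.span B"
    by (rule cmat.maximal_independent_subset)
  interpret pair: vector_space_pair "cscale :: complex \<Rightarrow> 'n cmat \<Rightarrow> 'n cmat" "cscale :: complex \<Rightarrow> 'n cmat \<Rightarrow> 'n cmat"
    by unfold_locales
  from pair.linear_independent_extend[OF B(2), of f] obtain \<nu> where
    \<nu>: "cmat_linear \<nu> \<and> (\<forall>A\<in>B. \<nu> A = f A)" ..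
  have lin: "cmat_linear \<nu>" using \<nu> by blast
  have "R A (\<nu> A)" if "A \<in> cmat.span B" for A
    using that
  proof (induction rule: cmat.span_induct)
    case base
    then show ?case
      unfolding cmat.subspace_def using add scale zero by (auto simp: cmat_linear_simps[OF lin])
  next
    case (step A)
    then show ?case using \<nu> f B(1) by auto
  qed
  then show ?thesis using lin B(3) by blast
qed

text \<open>The value of \<open>p (T)\<close> at \<open>A\<close>, by Horner's scheme as in the definition
  of \<open>poly\<close>.\<close>

definition poly_operator :: "('n::finite cmat \<Rightarrow> 'n cmat) \<Rightarrow> complex poly \<Rightarrow> 'n cmat \<Rightarrow> 'n cmat" where
  "poly_operator T p = fold_coeffs (\<lambda>a f A. cscale a A + T (f A)) p (\<lambda>_. 0)"

context
  fixes T :: "'n::finite cmat \<Rightarrow> 'n cmat"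
  assumes T: "cmat_linear T"
begin

lemma poly_operator_0: "poly_operator T 0 A = 0"
  by (simp add: poly_operator_def)

lemma poly_operator_pCons: "poly_operator T (pCons a p) A = cscale a A + T (poly_operator T p A)"
  by (cases "p = 0 \<and> a = 0") (auto simp: poly_operator_def cmat_linear_simps[OF T])

lemma poly_operator_linear: "cmat_linear (poly_operator T p)"
proof (induction p)
  case 0
  then show ?case by (intro cmat_linearI) (simp_all add: poly_operator_0)
next
  case (pCons a p)
  then show ?case
    by (intro cmat_linearI)
      (simp_all add: poly_operator_pCons cmat_linear_simps[OF T] cmat_linear_simps algebra_simps
        cmat.scale_right_distrib)
qed

lemma poly_operator_add: "poly_operator T (p + q) A = poly_operator T p A + poly_operator T q A"
  by (induction p q rule: poly_induct2)
    (simp_all add: poly_operator_0 poly_operator_pCons cmat_linear_simps[OF T] cmat.scale_left_distrib)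

lemma poly_operator_smult: "poly_operator T (smult c p) A = cscale c (poly_operator T p A)"
  by (induction p)
    (simp_all add: poly_operator_0 poly_operator_pCons cmat_linear_simps[OF T] cmat.scale_right_distrib)

lemma poly_operator_mult: "poly_operator T (p * q) A = poly_operator T p (poly_operator T q A)"
  by (induction p)
    (simp_all add: poly_operator_0 poly_operator_pCons poly_operator_add poly_operator_smult
      cmat_linear_simps[OF T])

lemma poly_operator_1: "poly_operator T 1 A = A"
  by (simp add: one_pCons poly_operator_0 poly_operator_pCons cmat_linear_simps[OF T])

lemma poly_operator_zero: "poly_operator T p 0 = 0"
  by (rule cmat_linear_simps[OF poly_operator_linear])

lemma poly_operator_sum: "poly_operator T (\<Sum>i\<in>I. p i) A = (\<Sum>i\<in>I. poly_operator T (p i) A)"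
  by (induction I rule: infinite_finite_induct) (simp_all add: poly_operator_0 poly_operator_add)

lemma poly_operator_monom: "poly_operator T (monom c i) A = cscale c ((T ^^ i) A)"
  by (induction i) (simp_all add: monom_0 monom_Suc poly_operator_0 poly_operator_pCons cmat_linear_simps[OF T])

lemma poly_operator_root_power:
  "poly_operator T ([:-c, 1:] ^ m) A = ((\<lambda>A. T A - cscale c A) ^^ m) A"
  by (induction m)
    (simp_all add: poly_operator_1 poly_operator_mult poly_operator_pCons poly_operator_0
      cmat_linear_simps[OF T] del: mult_pCons_left)

lemma poly_operator_dvd: "poly_operator T p A = 0 \<Longrightarrow> p dvd q \<Longrightarrow> poly_operator T q A = 0"
  by (auto simp: dvd_def mult.commute[of p] poly_operator_mult poly_operator_zero)

lemma poly_operator_in_subspace: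
  assumes V: "cmat.subspace V" "\<And>A. A \<in> V \<Longrightarrow> T A \<in> V" and A: "A \<in> V"
  shows "poly_operator T p A \<in> V"
  by (induction p)
    (simp_all add: poly_operator_0 poly_operator_pCons assms cmat.subspace_0 cmat.subspace_add
      cmat.subspace_scale)

text \<open>Finite dimension: \<open>A, T A, T\<^sup>2 A, \<dots>\<close> are linearly dependent.\<close>

lemma annihilating_polynomial_at: "\<exists>p. p \<noteq> 0 \<and> poly_operator T p A = 0"
proof -
  define N where "N = card (range (\<lambda>(k, l). matrix_unit k l :: 'n cmat))"
  let ?v = "\<lambda>i. (T ^^ i) A"
  show ?thesis
  proof (cases "inj_on ?v {..N}")
    case False
    then obtain i j where ij: "i \<noteq> j" "?v i = ?v j" unfolding inj_on_def by blast
    then have "coeff (monom 1 i - monom 1 j :: complex poly) i \<noteq> 0" by simp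
    then have "monom 1 i - monom 1 j \<noteq> (0 :: complex poly)" by (metis coeff_0)
    moreover have "poly_operator T (monom 1 i + smult (- 1) (monom 1 j)) A = 0"
      using ij(2) by (simp only: poly_operator_add poly_operator_smult poly_operator_monom) simp
    then have "poly_operator T (monom 1 i - monom 1 j) A = 0" by simp
    ultimately show ?thesis by blast
  next
    case True
    have "cmat.dependent (?v ` {..N})"
    proof (rule ccontr)
      assume "cmat.independent (?v ` {..N})"
      from cmat.independent_span_bound[OF _ this, of "range (\<lambda>(k, l). matrix_unit k l)"]
      have "card (?v ` {..N}) \<le> N" unfolding span_matrix_units N_def by simp
      then show False using card_image[OF True] by simp
    qed
    then obtain u where u: "\<exists>v\<in>?v ` {..N}. u v \<noteq> 0" "(\<Sum>v\<in>?v ` {..N}. cscale (u v) v) = 0"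
      using cmat.dependent_finite[of "?v ` {..N}"] by auto
    define p where "p = (\<Sum>i\<le>N. monom (u (?v i)) i)"
    obtain i where "i \<le> N" "u (?v i) \<noteq> 0" using u(1) by blast
    then have "coeff p i \<noteq> 0" unfolding p_def by (simp add: coeff_sum)
    then have "p \<noteq> 0" by auto
    moreover have "poly_operator T p A = 0"
      using u(2) unfolding p_def poly_operator_sum poly_operator_monom
      by (simp add: sum.reindex[OF True])
    ultimately show ?thesis by blast
  qed
qed

lemma annihilating_polynomial: "\<exists>p. p \<noteq> 0 \<and> (\<forall>A. poly_operator T p A = 0)"
proof -
  obtain p where p: "\<And>A. p A \<noteq> 0" "\<And>A. poly_operator T (p A) A = 0"
    using annihilating_polynomial_at by metis
  let ?U = "range (\<lambda>(k, l). matrix_unit k l :: 'n cmat)"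
  let ?q = "\<Prod>A\<in>?U. p A"
  have "poly_operator T ?q A = 0" for A
  proof -
    have "A \<in> cmat.span ?U" unfolding span_matrix_units by simp
    then show ?thesis
    proof (induction rule: cmat.span_induct)
      case base
      then show ?case
        unfolding cmat.subspace_def by (auto simp: cmat_linear_simps[OF poly_operator_linear])
    next
      case (step A)
      then show ?case by (intro poly_operator_dvd[OF p(2)] dvd_prodI) auto
    qed
  qed
  moreover have "?q \<noteq> 0" using p(1) by simp
  ultimately show ?thesis by blast
qed

end

text \<open>If \<open>y\<close> is a multiple of \<open>q\<close> with value \<open>1\<close> at
  \<open>c\<close>, then \<open>(1 - y)\<^sup>m\<close> is divisible by \<open>(x -
  c)\<^sup>m\<close> and congruent to \<open>1\<close> modulo \<open>q\<close>.\<close>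

lemma unit_modulo_root_power:
  fixes q :: "complex poly"
  assumes "poly q c \<noteq> 0"
  shows "\<exists>u v. [:-c, 1:] ^ m * u = 1 - q * v"
proof -
  define y where "y = smult (1 / poly q c) q"
  have "poly (1 - y) c = 0" using assms by (simp add: y_def)
  then obtain s where s: "1 - y = [:-c, 1:] * s" unfolding poly_eq_0_iff_dvd by (auto simp: dvd_def)
  have "1 - (1 - y) ^ m = y * (\<Sum>i<m. (1 - y) ^ i)"
    by (simp add: one_diff_power_eq)
  also have "\<dots> = q * smult (1 / poly q c) (\<Sum>i<m. (1 - y) ^ i)" by (simp add: y_def)
  finally have "(1 - y) ^ m = 1 - q * smult (1 / poly q c) (\<Sum>i<m. (1 - y) ^ i)"
    by (simp add: algebra_simps)
  then show ?thesis unfolding s power_mult_distrib by blast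
qed

text \<open>If \<open>p (T) = 0\<close>, the operator \<open>P (T)\<close> maps everything into the
  generalized eigenspace of \<open>T\<close> for \<open>c\<close> and is the identity on the
  kernel of \<open>(T - c)\<^sup>M\<close>. Being a polynomial in \<open>T\<close>, it preserves
  all invariant subspaces.\<close>

lemma projection_polynomial:
  fixes p :: "complex poly"
  assumes "p \<noteq> 0"
  shows "\<exists>P m. [:-c, 1:] ^ M dvd 1 - P \<and> p dvd [:-c, 1:] ^ m * P"
proof -
  obtain q where q: "p = [:-c, 1:] ^ Polynomial.order c p * q" "\<not> [:-c, 1:] dvd q"
    using order_decomp[OF assms] by blast
  then have "poly q c \<noteq> 0" by (simp add: poly_eq_0_iff_dvd)
  then obtain u v where uv: "[:-c, 1:] ^ M * u = 1 - q * v"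
    using unit_modulo_root_power by blast
  then have "[:-c, 1:] ^ M dvd 1 - q * v" by (metis dvd_triv_left)
  moreover have "p dvd [:-c, 1:] ^ Polynomial.order c p * (q * v)"
    by (metis q(1) dvd_triv_left mult.assoc)
  ultimately show ?thesis by blast
qed

definition ad_shift :: "'n::finite cmat \<Rightarrow> complex \<Rightarrow> 'n cmat \<Rightarrow> 'n cmat" where
  "ad_shift S c A = lie S A - cscale c A"

text \<open>Generalized eigenspaces of \<open>ad S\<close> on all matrices, and not only on a Lie algebra:
  they are compatible with the matrix product, and hence with exponentials.\<close>

definition weight_space :: "'n::finite cmat \<Rightarrow> complex \<Rightarrow> 'n cmat set" where
  "weight_space S c = {A. \<exists>m. (ad_shift S c ^^ m) A = 0}"

lemma ad_shift_linear: "cmat_linear (ad_shift S c)"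
  by (rule cmat_linearI)
    (simp_all add: ad_shift_def lie_linear cmat.scale_right_distrib cmat.scale_right_diff_distrib mult.commute)

lemma funpow_linear: "cmat_linear T \<Longrightarrow> cmat_linear (T ^^ m)"
proof (induction m)
  case 0
  then show ?case by (intro cmat_linearI) simp_all
next
  case (Suc m)
  then show ?case by (intro cmat_linearI) (simp_all add: cmat_linear_simps[OF Suc.prems] cmat_linear_simps)
qed

lemmas ad_shift_power_simps = cmat_linear_simps[OF funpow_linear[OF ad_shift_linear]]

lemma ad_shift_power_mono: "(ad_shift S c ^^ m) A = 0 \<Longrightarrow> m \<le> k \<Longrightarrow> (ad_shift S c ^^ k) A = 0"
  by (rotate_tac, induction k rule: dec_induct) (simp_all add: cmat_linear_simps[OF ad_shift_linear])

lemma weight_space_subspace: "cmat.subspace (weight_space S c)"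
proof (rule cmat.subspaceI)
  show "0 \<in> weight_space S c" unfolding weight_space_def by (auto intro: exI[of _ 0])
next
  fix A B assume "A \<in> weight_space S c" "B \<in> weight_space S c"
  then obtain m k where "(ad_shift S c ^^ m) A = 0" "(ad_shift S c ^^ k) B = 0"
    unfolding weight_space_def by blast
  then have "(ad_shift S c ^^ max m k) (A + B) = 0"
    using ad_shift_power_mono[of m S c A "max m k"] ad_shift_power_mono[of k S c B "max m k"]
    by (simp add: ad_shift_power_simps)
  then show "A + B \<in> weight_space S c" unfolding weight_space_def by blast
next
  fix k A assume "A \<in> weight_space S c"
  then obtain m where "(ad_shift S c ^^ m) A = 0" unfolding weight_space_def by blast
  then have "(ad_shift S c ^^ m) (cscale k A) = 0" by (simp add: ad_shift_power_simps)
  then show "cscale k A \<in> weight_space S c" unfolding weight_space_def by blast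
qed

lemma weight_spaceI: "lie S A = cscale c A \<Longrightarrow> A \<in> weight_space S c"
  unfolding weight_space_def by (auto intro!: exI[of _ 1] simp: ad_shift_def)

text \<open>\<open>ad S - (a + b)\<close> satisfies the Leibniz rule with respect to \<open>ad S - a\<close>
  and \<open>ad S - b\<close>; so its power \<open>i + j\<close> kills \<open>A B\<close> if the
  powers \<open>i\<close> and \<open>j\<close> of the latter kill \<open>A\<close> and
  \<open>B\<close>.\<close>

lemma weight_space_mult:
  assumes "A \<in> weight_space S a" "B \<in> weight_space S b"
  shows "A ** B \<in> weight_space S (a + b)"
proof -
  have "(ad_shift S (a + b) ^^ n) (A ** B) = 0"
    if "(ad_shift S a ^^ i) A = 0" "(ad_shift S b ^^ j) B = 0" "n = i + j" for i j n A B
    using that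
  proof (induction n arbitrary: i j A B)
    case 0
    then show ?case by (simp add: matrix_mult_linear)
  next
    case (Suc n)
    have Leibniz: "ad_shift S (a + b) (A ** B) = ad_shift S a A ** B + A ** ad_shift S b B"
      by (simp add: ad_shift_def lie_def matrix_mult_linear matrix_mul_assoc cmat.scale_left_distrib)
    show ?case
    proof (cases "i = 0 \<or> j = 0")
      case True
      then have "A = 0 \<or> B = 0" using Suc.prems by auto
      then show ?thesis by (auto simp: matrix_mult_linear ad_shift_power_simps simp del: funpow.simps)
    next
      case False
      then obtain i' j' where ij: "i = Suc i'" "j = Suc j'" by (metis not0_implies_Suc)
      have "(ad_shift S (a + b) ^^ n) (ad_shift S a A ** B) = 0"
        using Suc.prems ij by (intro Suc.IH[of i' _ j]) (simp_all add: funpow_swap1)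
      moreover have "(ad_shift S (a + b) ^^ n) (A ** ad_shift S b B) = 0"
        using Suc.prems ij by (intro Suc.IH[of i _ j']) (simp_all add: funpow_swap1)
      ultimately show ?thesis
        by (simp add: funpow_Suc_right Leibniz ad_shift_power_simps del: funpow.simps)
    qed
  qed
  then show ?thesis using assms unfolding weight_space_def by blast
qed

lemma weight_space_ad_invariant:
  assumes "A \<in> weight_space S c"
  shows "lie S A \<in> weight_space S c"
proof -
  have "S \<in> weight_space S 0" by (rule weight_spaceI) (simp add: lie_def)
  then have "S ** A \<in> weight_space S c" "A ** S \<in> weight_space S c"
    using weight_space_mult[of S S 0 A c] weight_space_mult[of A S c S 0] assms by auto
  then show ?thesis unfolding lie_def by (intro cmat.subspace_diff weight_space_subspace)
qed

lemma weight_space_trivial: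
  assumes p: "\<And>A. poly_operator (lie S) p A = 0" and c: "poly p c \<noteq> 0"
  shows "weight_space S c = {0}"
proof -
  have "A = 0" if A: "A \<in> weight_space S c" for A
  proof -
    obtain m where "(ad_shift S c ^^ m) A = 0" using A unfolding weight_space_def by blast
    then have m: "poly_operator (lie S) ([:-c, 1:] ^ m) A = 0"
      unfolding poly_operator_root_power[OF cmat_linear_lie] ad_shift_def .
    obtain u v where uv: "[:-c, 1:] ^ m * u = 1 - p * v" using unit_modulo_root_power[OF c] by blast
    have "A = poly_operator (lie S) (u * [:-c, 1:] ^ m + p * v) A"
      using uv by (simp add: mult.commute poly_operator_1 cmat_linear_lie)
    also have "\<dots> = 0"
      by (simp only: poly_operator_add poly_operator_mult cmat_linear_lie m p poly_operator_zero)
        simp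
    finally show ?thesis .
  qed
  moreover have "0 \<in> weight_space S c" by (rule cmat.subspace_0[OF weight_space_subspace])
  ultimately show ?thesis by blast
qed

text \<open>The even weights up to \<open>- 2 * k\<close>. These subspaces multiply like the powers of an
  ideal (\<open>weights_below_mult\<close>) and vanish for large \<open>k\<close>; the index is
  an integer because \<open>X\<close> has index \<open>- 1\<close>.\<close>

definition weights_below :: "'n::finite cmat \<Rightarrow> int \<Rightarrow> 'n cmat set" where
  "weights_below S k = cmat.span (\<Union>j\<in>{k..}. weight_space S (of_int (- 2 * j)))"

lemma weights_below_subspace: "cmat.subspace (weights_below S k)"
  unfolding weights_below_def by (rule cmat.subspace_span)

lemma weight_space_subset_weights_below:
  "k \<le> j \<Longrightarrow> weight_space S (of_int (- 2 * j)) \<subseteq> weights_below S k"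
  unfolding weights_below_def by (intro order_trans[OF _ cmat.span_superset]) auto

lemma weights_below_induct:
  assumes "A \<in> weights_below S k" "cmat.subspace V"
    and "\<And>j. k \<le> j \<Longrightarrow> weight_space S (of_int (- 2 * j)) \<subseteq> V"
  shows "A \<in> V"
proof -
  have "weights_below S k \<subseteq> V"
    unfolding weights_below_def using assms(2,3) by (intro cmat.span_minimal) auto
  then show ?thesis using assms(1) by blast
qed

lemma weights_below_antimono: "k \<le> l \<Longrightarrow> weights_below S l \<subseteq> weights_below S k"
  unfolding weights_below_def by (intro cmat.span_mono UN_mono) auto

lemma weights_below_mult:
  assumes A: "A \<in> weights_below S k" and B: "B \<in> weights_below S l"
  shows "A ** B \<in> weights_below S (k + l)"
proof -
  have "A \<in> {A. \<forall>B\<in>weights_below S l. A ** B \<in> weights_below S (k + l)}"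
    using A
  proof (rule weights_below_induct)
    show "cmat.subspace {A. \<forall>B\<in>weights_below S l. A ** B \<in> weights_below S (k + l)}"
      using weights_below_subspace[of S "k + l"] unfolding cmat.subspace_def
      by (simp add: matrix_mult_linear)
  next
    fix i assume i: "k \<le> i"
    show "weight_space S (of_int (- 2 * i)) \<subseteq> {A. \<forall>B\<in>weights_below S l. A ** B \<in> weights_below S (k + l)}"
    proof (intro subsetI CollectI ballI)
      fix A B assume A: "A \<in> weight_space S (of_int (- 2 * i))" and B: "B \<in> weights_below S l"
      have "B \<in> {B. A ** B \<in> weights_below S (k + l)}"
        using B
      proof (rule weights_below_induct)
        show "cmat.subspace {B. A ** B \<in> weights_below S (k + l)}"
          using weights_below_subspace[of S "k + l"] unfolding cmat.subspace_def
          by (simp add: matrix_mult_linear)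
      next
        fix j assume j: "l \<le> j"
        have "A ** B \<in> weights_below S (k + l)" if "B \<in> weight_space S (of_int (- 2 * j))" for B
        proof -
          have "A ** B \<in> weight_space S (of_int (- 2 * (i + j)))"
            using weight_space_mult[OF A that] by (simp add: algebra_simps)
          then show ?thesis using weight_space_subset_weights_below[of "k + l" "i + j" S] i j by auto
        qed
        then show "weight_space S (of_int (- 2 * j)) \<subseteq> {B. A ** B \<in> weights_below S (k + l)}" by blast
      qed
      then show "A ** B \<in> weights_below S (k + l)" by blast
    qed
  qed
  then show ?thesis using B by blast
qed

text \<open>The weights are roots of an annihilating polynomial of \<open>ad S\<close>.\<close>

lemma weights_below_eventually_trivial: "\<exists>N. \<forall>k\<ge>N. weights_below S k = {0}"
proof -
  obtain p where p: "p \<noteq> 0" "\<And>A. poly_operator (lie S) p A = 0"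
    using annihilating_polynomial[OF cmat_linear_lie] by blast
  have "inj (\<lambda>j :: int. of_int (- 2 * j) :: complex)" by (auto simp: inj_on_def)
  then have "finite ((\<lambda>j :: int. of_int (- 2 * j)) -` {x. poly p x = 0})"
    using poly_roots_finite[OF p(1)] by (intro finite_vimageI)
  from bdd_above_finite[OF this] obtain M where
    "\<forall>j\<in>(\<lambda>j :: int. of_int (- 2 * j)) -` {x. poly p x = 0}. j \<le> M"
    unfolding bdd_above_def ..
  then have M: "j \<le> M" if "poly p (of_int (- 2 * j)) = 0" for j
    using that by simp
  define N where "N = M + 1"
  have N: "j < N" if "poly p (of_int (- 2 * j)) = 0" for j
    using M[OF that] by (simp add: N_def)
  have "weights_below S k = {0}" if k: "N \<le> k" for k
  proof -
    have trivial: "weight_space S (of_int (- 2 * j)) = {0}" if "k \<le> j" for j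
    proof (rule weight_space_trivial[OF p(2)])
      show "poly p (of_int (- 2 * j)) \<noteq> 0" using N[of j] k that by linarith
    qed
    have "A \<in> {0}" if "A \<in> weights_below S k" for A
      using that by (rule weights_below_induct) (simp_all only: cmat.subspace_single_0 trivial order_refl)
    then show ?thesis using cmat.subspace_0[OF weights_below_subspace[of S k]] by blast
  qed
  then show ?thesis by blast
qed

lemma weights_below_ad_invariant:
  assumes "A \<in> weights_below S k"
  shows "lie S A \<in> weights_below S k"
proof -
  have "A \<in> {A. lie S A \<in> weights_below S k}"
    using assms
  proof (rule weights_below_induct)
    show "cmat.subspace {A. lie S A \<in> weights_below S k}"
      using weights_below_subspace[of S k] unfolding cmat.subspace_def by (simp add: lie_linear)
    show "weight_space S (of_int (- 2 * j)) \<subseteq> {A. lie S A \<in> weights_below S k}" if "k \<le> j" for j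
      using weight_space_ad_invariant weight_space_subset_weights_below[OF that] by blast
  qed
  then show ?thesis by blast
qed

lemma weights_below_split:
  assumes "A \<in> weights_below S k"
  shows "\<exists>B\<in>weight_space S (of_int (- 2 * k)). \<exists>C\<in>weights_below S (k + 1). A = B + C"
proof -
  have "A \<in> {B + C |B C. B \<in> weight_space S (of_int (- 2 * k)) \<and> C \<in> weights_below S (k + 1)}"
    using assms
  proof (rule weights_below_induct)
    show "cmat.subspace {B + C |B C. B \<in> weight_space S (of_int (- 2 * k)) \<and> C \<in> weights_below S (k + 1)}"
      by (rule cmat.subspace_sums[OF weight_space_subspace weights_below_subspace])
    fix j assume j: "k \<le> j"
    show "weight_space S (of_int (- 2 * j))
      \<subseteq> {B + C |B C. B \<in> weight_space S (of_int (- 2 * k)) \<and> C \<in> weights_below S (k + 1)}"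
    proof
      fix A assume A: "A \<in> weight_space S (of_int (- 2 * j))"
      show "A \<in> {B + C |B C. B \<in> weight_space S (of_int (- 2 * k)) \<and> C \<in> weights_below S (k + 1)}"
      proof (cases "j = k")
        case True
        have "A = A + 0" by simp
        then show ?thesis using A True cmat.subspace_0[OF weights_below_subspace] by blast
      next
        case False
        then have "A \<in> weights_below S (k + 1)"
          using A j weight_space_subset_weights_below[of "k + 1" j S] by auto
        moreover have "A = 0 + A" by simp
        ultimately show ?thesis using cmat.subspace_0[OF weight_space_subspace] by blast
      qed
    qed
  qed
  then show ?thesis by blast
qed


section \<open>Conjugation into the slice\<close>

lemma cmat_linear_lie_shift: "cmat_linear (\<lambda>A. lie S A + cscale c A)"
  by (rule cmat_linearI)
    (simp_all add: lie_linear cmat.scale_right_distrib mult.commute)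

text \<open>If \<open>X\<close> has weight \<open>c\<close>, then \<open>ad X\<close> raises weights by
  \<open>c\<close>.\<close>

lemma poly_operator_lie_shift:
  fixes S X A :: "'n::finite cmat"
  assumes X: "lie S X = cscale c X"
  shows "poly_operator (lie S) p (lie X A) = lie X (poly_operator (\<lambda>A. lie S A + cscale c A) p A)"
proof (induction p)
  case 0
  then show ?case by (simp add: poly_operator_0 cmat_linear_lie cmat_linear_lie_shift lie_linear)
next
  case (pCons a p)
  have "lie S (lie X B) = lie X (lie S B) + lie (lie S X) B" for B
    unfolding lie_def by (simp add: matrix_mult_linear matrix_mul_assoc)
  then have "lie S (lie X B) = lie X (lie S B + cscale c B)" for B
    by (simp add: X lie_linear)
  then show ?case
    using pCons by (simp add: poly_operator_pCons cmat_linear_lie cmat_linear_lie_shift lie_linear)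
qed

lemma matrix_power_weights_below:
  assumes "A \<in> weights_below S k"
  shows "matrix_power A n \<in> weights_below S (int n * k)"
proof (induction n)
  case 0
  have "mat 1 \<in> weight_space S (of_int (- 2 * 0))"
    by (intro weight_spaceI) (simp add: lie_def)
  then show ?case using weight_space_subset_weights_below[of 0 0 S] by auto
next
  case (Suc n)
  have "k + int n * k = int (Suc n) * k" by (simp add: algebra_simps)
  then show ?case using weights_below_mult[OF assms Suc] by simp
qed

lemma exp_truncated_weights_below:
  assumes A: "A \<in> weights_below S k" and k: "0 \<le> k"
  shows "exp_truncated (Suc (Suc N)) A - mat 1 - A \<in> weights_below S (2 * k)"
proof -
  have "exp_truncated (Suc (Suc N)) A - mat 1 - A
      = (\<Sum>n<N. cscale (1 / fact (Suc (Suc n))) (matrix_power A (Suc (Suc n))))"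
    unfolding exp_truncated_def sum.lessThan_Suc_shift by simp
  also have "\<dots> \<in> weights_below S (2 * k)"
  proof (intro cmat.subspace_sum cmat.subspace_scale weights_below_subspace)
    fix n
    have "2 * k \<le> int (Suc (Suc n)) * k" using k by (intro mult_right_mono) auto
    then show "matrix_power A (Suc (Suc n)) \<in> weights_below S (2 * k)"
      using matrix_power_weights_below[OF A, of "Suc (Suc n)"] weights_below_antimono by blast
  qed
  finally show ?thesis .
qed

lemma weights_below_add: "A \<in> weights_below S k \<Longrightarrow> B \<in> weights_below S k \<Longrightarrow> A + B \<in> weights_below S k"
  by (rule cmat.subspace_add[OF weights_below_subspace])

lemma weights_below_diff: "A \<in> weights_below S k \<Longrightarrow> B \<in> weights_below S k \<Longrightarrow> A - B \<in> weights_below S k"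
  by (rule cmat.subspace_diff[OF weights_below_subspace])

lemma weights_below_mult_le:
  "A \<in> weights_below S k \<Longrightarrow> B \<in> weights_below S l \<Longrightarrow> i \<le> k + l \<Longrightarrow> A ** B \<in> weights_below S i"
  using weights_below_mult weights_below_antimono by blast

text \<open>To first order in \<open>A\<close>, conjugation by \<open>exp A\<close> adds \<open>[A, X +
  B]\<close>. Everything except \<open>[A, X]\<close> has weights at most \<open>- 2 *
  k\<close>: the commutator \<open>[A, B]\<close>, since \<open>B\<close> has nonpositive
  weights, and the terms of order at least two in \<open>A\<close>, since a single factor
  \<open>X\<close> of weight \<open>2\<close> is outweighed by two factors \<open>A\<close>.\<close>

lemma exp_truncated_conjugation:
  fixes S A M X :: "'n::finite cmat"
  assumes A: "A \<in> weights_below S k" and k: "1 \<le> k"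
    and X: "X \<in> weights_below S (- 1)" and B: "B \<in> weights_below S 0"
  shows "exp_truncated (Suc (Suc N)) A ** (X + B) ** exp_truncated (Suc (Suc N)) (- A)
    - (X + B - lie X A) \<in> weights_below S k"
proof -
  define M where "M = X + B"
  define R where "R = exp_truncated (Suc (Suc N)) A - mat 1 - A"
  define R' where "R' = exp_truncated (Suc (Suc N)) (- A) - mat 1 - (- A)"
  have mA: "- A \<in> weights_below S k"
    using cmat.subspace_neg[OF weights_below_subspace A] .
  have R: "R \<in> weights_below S (2 * k)" and R': "R' \<in> weights_below S (2 * k)"
    unfolding R_def R'_def using k by (intro exp_truncated_weights_below A mA; simp)+
  have M: "M \<in> weights_below S (- 1)"
    unfolding M_def using X B weights_below_antimono[of "- 1" 0 S] by (intro weights_below_add) auto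
  have exps: "exp_truncated (Suc (Suc N)) A = mat 1 + A + R"
    "exp_truncated (Suc (Suc N)) (- A) = mat 1 - A + R'"
    unfolding R_def R'_def by simp_all
  have "exp_truncated (Suc (Suc N)) A ** M ** exp_truncated (Suc (Suc N)) (- A) - (X + B - lie X A)
      = (A ** B - B ** A) + (R ** M + M ** R' - A ** M ** A + A ** M ** R' - R ** M ** A + R ** M ** R')"
    unfolding exps lie_def by (simp add: matrix_mult_linear M_def algebra_simps)
  also have "\<dots> \<in> weights_below S k"
  proof (intro weights_below_add weights_below_diff)
    have AM: "A ** M \<in> weights_below S (k - 1)" and RM: "R ** M \<in> weights_below S (2 * k - 1)"
      using weights_below_mult[OF A M] weights_below_mult[OF R M] by simp_all
    show "A ** B \<in> weights_below S k" "B ** A \<in> weights_below S k"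
      using weights_below_mult[OF A B] weights_below_mult[OF B A] by simp_all
    show "R ** M \<in> weights_below S k" "M ** R' \<in> weights_below S k"
      using k by (intro weights_below_mult_le[OF R M] weights_below_mult_le[OF M R']; simp)+
    show "A ** M ** A \<in> weights_below S k" "A ** M ** R' \<in> weights_below S k"
      using k by (intro weights_below_mult_le[OF AM A] weights_below_mult_le[OF AM R']; simp)+
    show "R ** M ** A \<in> weights_below S k" "R ** M ** R' \<in> weights_below S k"
      using k by (intro weights_below_mult_le[OF RM A] weights_below_mult_le[OF RM R']; simp)+
  qed
  finally show ?thesis unfolding M_def .
qed

lemma Ad_eq: "x ** y = mat 1 \<Longrightarrow> Ad x A = x ** A ** y"
  unfolding Ad_def using matrix_inv_eq by metis

text \<open>\<open>S\<close> plays the part of the element \<open>h\<^sub>0\<close> of the triple, which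
  provides the grading, and \<open>Z + X\<close> is the slice.\<close>

locale kostant_slice =
  fixes G Z :: "'n::finite cmat set" and S X :: "'n cmat"
  assumes group: "linear_algebraic_group G"
    and S: "S \<in> Lie G" and X: "X \<in> Lie G" and weight_X: "lie S X = cscale 2 X"
    and Z_subspace: "cmat.subspace Z" and Z_subset: "Z \<subseteq> Lie G"
    and Z_invariant: "\<And>A. A \<in> Z \<Longrightarrow> lie S A \<in> Z"
    and Z_complement: "Lie G = {A + B |A B. A \<in> Z \<and> B \<in> lie X ` Lie G}"
begin

lemma subgroup_G: "subgroup G GL"
  using group unfolding linear_algebraic_group_def by blast

lemma X_weights: "X \<in> weights_below S (- 1)"
  using weight_space_subset_weights_below[of "- 1" "- 1" S] weight_spaceI[of S X 2] weight_X by auto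

text \<open>For \<open>k \<ge> 0\<close>, the elements of the Lie algebra with nonpositive even weights that
  lie in \<open>Z\<close> up to an error whose weights are at most \<open>- 2 * k\<close>. For
  \<open>k = 0\<close> this contains the elements of weight \<open>0\<close>, and for large
  \<open>k\<close> it is contained in \<open>Z\<close>.\<close>

definition slice_modulo :: "int \<Rightarrow> 'n cmat set" where
  "slice_modulo k = {A + B |A B. A \<in> Z \<inter> weights_below S 0 \<and> B \<in> weights_below S k \<inter> Lie G}"

lemma slice_modulo_subspace: "cmat.subspace (slice_modulo k)"
  unfolding slice_modulo_def
  by (intro cmat.subspace_sums cmat.subspace_inter Z_subspace weights_below_subspace Lie_subspace)

lemma slice_modulo_subset: "slice_modulo k \<subseteq> Lie G"
  unfolding slice_modulo_def using Z_subset by (auto intro: cmat.subspace_add[OF Lie_subspace])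

lemma slice_modulo_weights: "0 \<le> k \<Longrightarrow> slice_modulo k \<subseteq> weights_below S 0"
  unfolding slice_modulo_def using weights_below_antimono[of 0 k S]
  by (auto intro: weights_below_add)

lemma weights_below_subset_slice_modulo: "weights_below S k \<inter> Lie G \<subseteq> slice_modulo k"
proof
  fix B assume "B \<in> weights_below S k \<inter> Lie G"
  moreover have "0 \<in> Z \<inter> weights_below S 0"
    using cmat.subspace_0[OF Z_subspace] cmat.subspace_0[OF weights_below_subspace] by blast
  moreover have "B = 0 + B" by simp
  ultimately show "B \<in> slice_modulo k" unfolding slice_modulo_def by blast
qed

text \<open>Write the error term as \<open>V' + [X, A']\<close> with \<open>V' \<in> Z\<close> and apply a
  polynomial \<open>P (ad S)\<close> that projects onto the weight \<open>- 2 * k\<close>. It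
  maps \<open>V'\<close> into \<open>Z\<close> and turns \<open>[X, A']\<close> into \<open>[X,
  A]\<close> with \<open>A\<close> of weight \<open>- 2 * (k + 1)\<close>.\<close>

lemma slice_modulo_step:
  assumes k: "0 \<le> k" and W: "W \<in> slice_modulo k"
  shows "\<exists>A. A \<in> weights_below S (k + 1) \<inter> Lie G \<and> W - lie X A \<in> slice_modulo (k + 1)"
proof -
  let ?c = "of_int (- 2 * k) :: complex"
  let ?T = "\<lambda>A. lie S A + cscale 2 A"
  obtain V B where V: "V \<in> Z" "V \<in> weights_below S 0" and B: "B \<in> weights_below S k" "B \<in> Lie G"
      and W_eq: "W = V + B"
    using W unfolding slice_modulo_def by blast
  obtain B0 C where B0: "B0 \<in> weight_space S ?c" and C: "C \<in> weights_below S (k + 1)" and B_eq: "B = B0 + C"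
    using weights_below_split[OF B(1)] by blast
  obtain M where M: "(ad_shift S ?c ^^ M) B0 = 0" using B0 unfolding weight_space_def by blast
  obtain p where p: "p \<noteq> 0" "\<forall>A. poly_operator (lie S) p A = 0"
    using annihilating_polynomial[OF cmat_linear_lie] by blast
  obtain q where q: "q \<noteq> 0" "\<forall>A. poly_operator ?T q A = 0"
    using annihilating_polynomial[OF cmat_linear_lie_shift] by blast
  \<comment> \<open>The factor \<open>q\<close> is needed because moving \<open>P\<close> past \<open>ad X\<close> replaces \<open>ad S\<close> by \<open>ad S + 2\<close>.\<close>
  obtain P m where P: "[:- ?c, 1:] ^ M dvd 1 - P" "p * q dvd [:- ?c, 1:] ^ m * P"
    using projection_polynomial[of "p * q", where c = ?c and M = M] p(1) q(1) by auto
  obtain V' A' where V': "V' \<in> Z" and A': "A' \<in> Lie G" and B_eq': "B = V' + lie X A'"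
    using B(2) Z_complement by blast
  define A where "A = poly_operator ?T P A'"
  define Y where "Y = poly_operator (lie S) P V'"
  have PB: "poly_operator (lie S) P B = Y + lie X A"
    unfolding B_eq' A_def Y_def poly_operator_lie_shift[OF weight_X, symmetric]
    by (rule cmat_linear_simps[OF poly_operator_linear[OF cmat_linear_lie]])
  have "p dvd [:- ?c, 1:] ^ m * P" "q dvd [:- ?c, 1:] ^ m * P"
    using P(2) by (rule dvd_mult_left, rule dvd_mult_right)
  then have P_annihilates: "poly_operator (lie S) ([:- ?c, 1:] ^ m * P) D = 0"
    "poly_operator ?T ([:- ?c, 1:] ^ m * P) D = 0" for D
    using poly_operator_dvd[OF cmat_linear_lie p(2)[rule_format]]
      poly_operator_dvd[OF cmat_linear_lie_shift q(2)[rule_format]] by auto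
  have Y_Z: "Y \<in> Z"
    unfolding Y_def by (rule poly_operator_in_subspace[OF cmat_linear_lie Z_subspace Z_invariant V'])
  have "(ad_shift S ?c ^^ m) Y = 0"
    using P_annihilates(1)[of V']
    unfolding poly_operator_mult[OF cmat_linear_lie] poly_operator_root_power[OF cmat_linear_lie]
      Y_def ad_shift_def .
  then have "Y \<in> weight_space S ?c" unfolding weight_space_def by blast
  then have Y: "Y \<in> weights_below S 0" using weight_space_subset_weights_below[OF k] by blast
  have shift: "ad_shift S (of_int (- 2 * (k + 1))) = (\<lambda>A. ?T A - cscale ?c A)"
    by (simp add: fun_eq_iff ad_shift_def cmat.scale_left_diff_distrib)
  have "(ad_shift S (of_int (- 2 * (k + 1))) ^^ m) A = 0"
    using P_annihilates(2)[of A']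
    unfolding poly_operator_mult[OF cmat_linear_lie_shift] poly_operator_root_power[OF cmat_linear_lie_shift]
      A_def shift .
  then have "A \<in> weight_space S (of_int (- 2 * (k + 1)))" unfolding weight_space_def by blast
  then have A: "A \<in> weights_below S (k + 1)" using weight_space_subset_weights_below by blast
  have lie_S_Lie: "lie S D \<in> Lie G" if "D \<in> Lie G" for D
    by (rule lie_Lie[OF subgroup_G S that])
  have A_Lie: "A \<in> Lie G"
    unfolding A_def
    by (rule poly_operator_in_subspace[OF cmat_linear_lie_shift Lie_subspace _ A'])
      (intro cmat.subspace_add cmat.subspace_scale Lie_subspace lie_S_Lie)
  have "poly_operator (lie S) ([:- ?c, 1:] ^ M) B0 = 0"
    using M unfolding poly_operator_root_power[OF cmat_linear_lie] ad_shift_def .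
  then have "poly_operator (lie S) (1 - P) B0 = 0"
    by (rule poly_operator_dvd[OF cmat_linear_lie _ P(1)])
  then have PB0: "poly_operator (lie S) P B0 = B0"
    using poly_operator_add[OF cmat_linear_lie[of S], where p = "1 - P" and q = P and A = B0]
    by (simp add: poly_operator_1 cmat_linear_lie)
  have "poly_operator (lie S) P C \<in> weights_below S (k + 1)"
    by (rule poly_operator_in_subspace[OF cmat_linear_lie weights_below_subspace weights_below_ad_invariant C])
  moreover have "B - poly_operator (lie S) P B = C - poly_operator (lie S) P C"
    unfolding B_eq cmat_linear_simps[OF poly_operator_linear[OF cmat_linear_lie]] PB0 by simp
  ultimately have rest: "B - poly_operator (lie S) P B \<in> weights_below S (k + 1)"
    using C by (simp add: weights_below_diff)
  have "poly_operator (lie S) P B \<in> Lie G"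
    by (rule poly_operator_in_subspace[OF cmat_linear_lie Lie_subspace lie_S_Lie B(2)])
  then have rest_Lie: "B - poly_operator (lie S) P B \<in> Lie G"
    by (rule cmat.subspace_diff[OF Lie_subspace B(2)])
  have "W - lie X A = (V + Y) + (B - poly_operator (lie S) P B)"
    unfolding W_eq PB by simp
  moreover have "V + Y \<in> Z \<inter> weights_below S 0"
    using V Y Y_Z cmat.subspace_add[OF Z_subspace] weights_below_add by blast
  ultimately have "W - lie X A \<in> slice_modulo (k + 1)"
    unfolding slice_modulo_def using rest rest_Lie by blast
  with A A_Lie show ?thesis by blast
qed

lemma linear_slice_modulo_step:
  assumes k: "0 \<le> k"
  shows "\<exists>\<nu>. cmat_linear \<nu> \<and> (\<forall>W\<in>slice_modulo k. \<nu> W \<in> weights_below S (k + 1) \<inter> Lie G \<and>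
    W - lie X (\<nu> W) \<in> slice_modulo (k + 1))"
proof (rule linear_choice[where R = "\<lambda>W A. A \<in> weights_below S (k + 1) \<inter> Lie G \<and> W - lie X A \<in> slice_modulo (k + 1)"])
  have sub: "cmat.subspace (weights_below S (k + 1) \<inter> Lie G)"
    by (intro cmat.subspace_inter weights_below_subspace Lie_subspace)
  show "\<exists>A. A \<in> weights_below S (k + 1) \<inter> Lie G \<and> W - lie X A \<in> slice_modulo (k + 1)"
    if "W \<in> slice_modulo k" for W
    by (rule slice_modulo_step[OF k that])
  show "A + A' \<in> weights_below S (k + 1) \<inter> Lie G \<and> W + W' - lie X (A + A') \<in> slice_modulo (k + 1)"
    if "A \<in> weights_below S (k + 1) \<inter> Lie G \<and> W - lie X A \<in> slice_modulo (k + 1)"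
      "A' \<in> weights_below S (k + 1) \<inter> Lie G \<and> W' - lie X A' \<in> slice_modulo (k + 1)" for W W' A A'
  proof -
    have eq: "W + W' - lie X (A + A') = (W - lie X A) + (W' - lie X A')" by (simp add: lie_linear)
    show ?thesis
      unfolding eq using that cmat.subspace_add[OF sub] cmat.subspace_add[OF slice_modulo_subspace] by blast
  qed
  show "cscale c A \<in> weights_below S (k + 1) \<inter> Lie G \<and> cscale c W - lie X (cscale c A) \<in> slice_modulo (k + 1)"
    if "A \<in> weights_below S (k + 1) \<inter> Lie G \<and> W - lie X A \<in> slice_modulo (k + 1)" for c W A
  proof -
    have eq: "cscale c W - lie X (cscale c A) = cscale c (W - lie X A)"
      by (simp add: lie_linear cmat.scale_right_diff_distrib)
    show ?thesis
      unfolding eq using that cmat.subspace_scale[OF sub] cmat.subspace_scale[OF slice_modulo_subspace] by blast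
  qed
  show "0 \<in> weights_below S (k + 1) \<inter> Lie G \<and> 0 - lie X 0 \<in> slice_modulo (k + 1)"
    using cmat.subspace_0[OF sub] cmat.subspace_0[OF slice_modulo_subspace] by (simp add: lie_linear)
qed

text \<open>The induction removes one weight at a time. The inverse \<open>g'\<close> of the conjugating
  element \<open>g\<close> is carried along: it exhibits \<open>inverse (det (g h))\<close> as a
  polynomial in \<open>h\<close>, and it becomes the morphism in the end.\<close>

lemma conjugate_into_slice_modulo:
  assumes D: "D \<subseteq> Lie G" "\<And>h. h \<in> D \<Longrightarrow> lie S h = 0"
  shows "\<exists>g g'. regular_matrix_on matrix_entries UNIV g \<and> regular_matrix_on matrix_entries UNIV g' \<and>
    (\<forall>h\<in>D. g h \<in> G \<and> g' h \<in> G \<and> g h ** g' h = mat 1 \<and>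
      g h ** (h + X) ** g' h - X \<in> slice_modulo (int k))"
proof (induction k)
  case 0
  have "h \<in> slice_modulo 0" if "h \<in> D" for h
  proof -
    have "h \<in> weight_space S (of_int (- 2 * 0))" using D(2)[OF that] by (intro weight_spaceI) simp
    then have "h \<in> weights_below S 0" using weight_space_subset_weights_below[of 0 0 S] by blast
    then show ?thesis using weights_below_subset_slice_modulo[of 0] D(1) that by blast
  qed
  then show ?case
    using subgroup_GL(2)[OF subgroup_G]
    by (intro exI[of _ "\<lambda>_. mat 1"]) (simp add: regular_matrix_on_const)
next
  case (Suc k)
  then obtain g g' where g: "regular_matrix_on matrix_entries UNIV g"
      and g': "regular_matrix_on matrix_entries UNIV g'"
      and IH: "\<And>h. h \<in> D \<Longrightarrow> g h \<in> G \<and> g' h \<in> G \<and> g h ** g' h = mat 1 \<and>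
        g h ** (h + X) ** g' h - X \<in> slice_modulo (int k)"
    by blast
  define W where "W h = g h ** (h + X) ** g' h - X" for h
  obtain \<nu> where \<nu>: "cmat_linear \<nu>"
      and step: "\<And>W. W \<in> slice_modulo (int k) \<Longrightarrow> \<nu> W \<in> weights_below S (int k + 1) \<inter> Lie G \<and>
        W - lie X (\<nu> W) \<in> slice_modulo (int k + 1)"
    using linear_slice_modulo_step[of "int k"] by auto
  obtain N where N: "\<And>k. N \<le> k \<Longrightarrow> weights_below S k = {0}"
    using weights_below_eventually_trivial by blast
  \<comment> \<open>All exponents below have weights at most \<open>- 2\<close>, so their powers vanish from \<open>nat N\<close> on.
    The double successor separates \<open>1 + A\<close> from the rest of the series.\<close>
  define m where "m = Suc (Suc (nat N))"
  let ?e = "\<lambda>h. exp_truncated m (\<nu> (W h))" and ?e' = "\<lambda>h. exp_truncated m (- \<nu> (W h))"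
  have W_regular: "regular_matrix_on matrix_entries UNIV W"
    unfolding W_def
    by (intro regular_matrix_on_diff regular_matrix_on_mult regular_matrix_on_add g g'
        regular_matrix_on_ident regular_matrix_on_const order_refl)
  then have \<nu>W: "regular_matrix_on matrix_entries UNIV (\<lambda>h. \<nu> (W h))"
    by (rule regular_matrix_on_linear[OF \<nu>])
  have "regular_matrix_on matrix_entries UNIV (\<lambda>h. 0 - \<nu> (W h))"
    by (intro regular_matrix_on_diff regular_matrix_on_const \<nu>W)
  then have \<nu>W': "regular_matrix_on matrix_entries UNIV (\<lambda>h. - \<nu> (W h))" by simp
  have conj: "?e h ** g h \<in> G \<and> g' h ** ?e' h \<in> G \<and> (?e h ** g h) ** (g' h ** ?e' h) = mat 1 \<and>
      (?e h ** g h) ** (h + X) ** (g' h ** ?e' h) - X \<in> slice_modulo (int (Suc k))"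
    if h: "h \<in> D" for h
  proof -
    note IH = IH[OF h]
    have Wh: "W h \<in> slice_modulo (int k)" using IH unfolding W_def by blast
    note step = step[OF Wh]
    define A where "A = \<nu> (W h)"
    have A: "A \<in> weights_below S (int k + 1)" "A \<in> Lie G" using step unfolding A_def by auto
    have mA: "- A \<in> Lie G" using cmat.subspace_neg[OF Lie_subspace A(2)] .
    have "N \<le> int m * (int k + 1)"
    proof -
      have "N \<le> int m * 1" unfolding m_def by simp
      also have "\<dots> \<le> int m * (int k + 1)" by (intro mult_left_mono) auto
      finally show ?thesis .
    qed
    then have nil: "matrix_power A m = 0"
      using matrix_power_weights_below[OF A(1), of m] N by blast
    moreover have "- A = cscale (- 1) A" by simp
    ultimately have nil': "matrix_power (- A) m = 0" by (simp add: matrix_power_cscale del: cmat.scale_minus_left)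
    have e: "exp_truncated m A \<in> G" "exp_truncated m (- A) \<in> G"
      by (rule exp_truncated_in_group[OF group A(2) nil] exp_truncated_in_group[OF group mA nil'])+
    have inverse: "exp_truncated m A ** exp_truncated m (- A) = mat 1"
      using exp_truncated_inverse[OF nil, of 1] by simp
    have "(exp_truncated m A ** g h) ** (g' h ** exp_truncated m (- A))
        = exp_truncated m A ** (g h ** g' h) ** exp_truncated m (- A)"
      by (simp add: matrix_mul_assoc)
    then have inverse': "(exp_truncated m A ** g h) ** (g' h ** exp_truncated m (- A)) = mat 1"
      using IH inverse by simp
    define E where "E = exp_truncated m A ** (X + W h) ** exp_truncated m (- A) - (X + W h - lie X A)"
    have W_Lie: "W h \<in> Lie G" using Wh slice_modulo_subset by blast
    have "Ad (exp_truncated m A) (X + W h) \<in> Lie G"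
      by (intro Ad_Lie[OF subgroup_G e(1)] cmat.subspace_add[OF Lie_subspace] X W_Lie)
    then have "exp_truncated m A ** (X + W h) ** exp_truncated m (- A) \<in> Lie G"
      by (simp add: Ad_eq[OF inverse])
    then have "E \<in> Lie G"
      unfolding E_def
      by (intro cmat.subspace_diff[OF Lie_subspace] cmat.subspace_add[OF Lie_subspace] X W_Lie
          lie_Lie[OF subgroup_G X A(2)])
    moreover have "E \<in> weights_below S (int k + 1)"
      unfolding E_def m_def
      using exp_truncated_conjugation[OF A(1) _ X_weights] Wh slice_modulo_weights[of "int k"] by auto
    ultimately have E: "E \<in> slice_modulo (int k + 1)"
      using weights_below_subset_slice_modulo by blast
    have "(exp_truncated m A ** g h) ** (h + X) ** (g' h ** exp_truncated m (- A)) - X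
        = exp_truncated m A ** (g h ** (h + X) ** g' h) ** exp_truncated m (- A) - X"
      by (simp add: matrix_mul_assoc)
    also have "\<dots> = exp_truncated m A ** (X + W h) ** exp_truncated m (- A) - X"
      by (simp add: W_def)
    also have "\<dots> = (W h - lie X A) + E" unfolding E_def by simp
    also have "\<dots> \<in> slice_modulo (int k + 1)"
      using step E unfolding A_def by (intro cmat.subspace_add[OF slice_modulo_subspace]) auto
    finally have "(exp_truncated m A ** g h) ** (h + X) ** (g' h ** exp_truncated m (- A)) - X
        \<in> slice_modulo (int (Suc k))"
      by (simp add: add.commute)
    then show ?thesis
      using inverse' e IH subgroup_GL(3)[OF subgroup_G] unfolding A_def by blast
  qed
  show ?case
  proof (rule exI[of _ "\<lambda>h. ?e h ** g h"], rule exI[of _ "\<lambda>h. g' h ** ?e' h"], rule conjI[OF _ conjI])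
    show "regular_matrix_on matrix_entries UNIV (\<lambda>h. ?e h ** g h)"
      by (rule regular_matrix_on_mult[OF regular_exp_truncated[OF \<nu>W] g])
    show "regular_matrix_on matrix_entries UNIV (\<lambda>h. g' h ** ?e' h)"
      by (rule regular_matrix_on_mult[OF g' regular_exp_truncated[OF \<nu>W']])
  qed (rule ballI, rule conj)
qed

lemma conjugate_into_slice:
  assumes D: "D \<subseteq> Lie G" "\<And>h. h \<in> D \<Longrightarrow> lie S h = 0"
  obtains g g' where "regular_matrix_on matrix_entries UNIV g" "regular_matrix_on matrix_entries UNIV g'"
    "\<And>h. h \<in> D \<Longrightarrow> g h \<in> G" "\<And>h. h \<in> D \<Longrightarrow> g' h \<in> G" "\<And>h. h \<in> D \<Longrightarrow> g h ** g' h = mat 1"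
    "\<And>h. h \<in> D \<Longrightarrow> g h ** (h + X) ** g' h - X \<in> Z"
proof -
  obtain N where "\<And>k. N \<le> k \<Longrightarrow> weights_below S k = {0}"
    using weights_below_eventually_trivial by blast
  then have "weights_below S (int (nat N)) = {0}" by simp
  then have "slice_modulo (int (nat N)) \<subseteq> Z"
    unfolding slice_modulo_def by auto
  then show ?thesis
    using conjugate_into_slice_modulo[OF D, of "nat N"] that by blast
qed

end


section \<open>Invariant polynomials and Weyl orbits\<close>

text \<open>Since \<open>[S, h + t X] = 2 t X\<close>, infinitesimal invariance says that the polynomial
  \<open>t \<mapsto> f (h + t X)\<close> has derivative zero for \<open>t \<noteq> 0\<close>;
  hence it is constant.\<close>

lemma invariant_polynomial_shift:
  fixes G :: "'n::finite cmat set"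
  assumes G: "subgroup G GL" and f: "f \<in> invariant_polynomials G"
    and Lie: "S \<in> Lie G" "h \<in> Lie G" "X \<in> Lie G"
    and weights: "lie S h = 0" "lie S X = cscale 2 X"
  shows "f (h + X) = f h"
proof -
  have f_poly: "f \<in> polynomial_functions" using f unfolding invariant_polynomials_def by blast
  from polynomial_gradient[OF this] obtain d where
    "(\<forall>i j. d i j \<in> polynomial_functions) \<and> has_gradient_on UNIV f d" ..
  then have d: "has_gradient_on UNIV f d" by blast
  let ?\<gamma> = "\<lambda>t. h + cscale t X"
  let ?D = "\<lambda>t. \<Sum>i\<in>UNIV. \<Sum>j\<in>UNIV. d i j (?\<gamma> t) * X $ i $ j"
  have "regular_matrix_on {\<lambda>t. t} UNIV ?\<gamma>"
    by (intro regular_matrix_on_add regular_matrix_on_cscale regular_matrix_on_const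
        regular_on_function_algebra function_algebra.gen) simp
  from regular_on_complex_poly[OF regular_on_compose_polynomial[OF f_poly this]]
  obtain q where q: "(\<lambda>t. f (?\<gamma> t)) = poly q" ..
  have D: "poly (pderiv q) t = ?D t" for t
  proof -
    have "(poly q has_field_derivative ?D t) (at t)"
      using has_gradient_onD[OF d has_matrix_derivative_line[of h X t]] unfolding q by simp
    then show ?thesis using DERIV_unique[OF poly_DERIV] by blast
  qed
  \<comment> \<open>The case \<open>t = 0\<close> carries no information, but \<open>pderiv q\<close> is a polynomial.\<close>
  have "t * ?D t = 0" for t
  proof -
    have "lie S (?\<gamma> t) = cscale (2 * t) X" by (simp add: lie_linear weights mult.commute)
    moreover have "?\<gamma> t \<in> Lie G"
      by (intro cmat.subspace_add[OF Lie_subspace] cmat.subspace_scale[OF Lie_subspace] Lie)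
    ultimately have "(\<Sum>i\<in>UNIV. \<Sum>j\<in>UNIV. d i j (?\<gamma> t) * cscale (2 * t) X $ i $ j) = 0"
      using invariant_polynomial_infinitesimal[OF G f d _ Lie(1), of "?\<gamma> t"] by simp
    moreover have "(\<Sum>i\<in>UNIV. \<Sum>j\<in>UNIV. d i j (?\<gamma> t) * cscale (2 * t) X $ i $ j) = 2 * (t * ?D t)"
      by (simp add: cscale_def sum_distrib_left mult_ac)
    ultimately show ?thesis by simp
  qed
  then have "poly ([:0, 1:] * pderiv q) t = 0" for t by (simp add: D)
  then have "[:0, 1:] * pderiv q = 0" by (simp only: poly_all_0_iff_0[symmetric]) blast
  then have "pderiv q = 0" by simp
  then have "degree q = 0" by (simp add: pderiv_eq_0_iff)
  then obtain c where "q = [:c:]" by (rule degree_eq_zeroE)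
  then show ?thesis using fun_cong[OF q, of 0] fun_cong[OF q, of 1] by simp
qed

lemma normalizer_subgroup_GL:
  fixes G H :: "'n::finite cmat set"
  assumes G: "subgroup G GL" and H: "H \<subseteq> G"
  shows "subgroup (normalizer (grp G) H) GL"
proof -
  interpret grp: Group.group "grp G" by (rule subgroup.subgroup_is_group[OF G group_GL])
  have "subgroup (normalizer (grp G) H) (grp G)"
    using H by (intro grp.normalizer_imp_subgroup) simp
  then show ?thesis using group.incl_subgroup[OF group_GL G] by simp
qed

lemma weyl_orbit_eq_Ad:
  "h \<in> Lie H \<Longrightarrow> weyl_orbit G H h = (\<lambda>x. Ad x h) ` normalizer (grp G) H"
proof -
  assume "h \<in> Lie H"
  then have "restrict (Ad x) (Lie H) h = Ad x h" for x by simp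
  moreover have "weyl_orbit G H h = {restrict (Ad x) (Lie H) h |x. x \<in> normalizer (grp G) H}"
    unfolding weyl_orbit_def weyl_group_def by blast
  ultimately show ?thesis by (simp only: Setcompr_eq_image)
qed

lemma Ad_mult:
  fixes x y :: "'n::finite cmat"
  assumes "invertible x" "invertible y"
  shows "Ad (x ** y) A = Ad x (Ad y A)"
proof -
  have "x ** y ** (matrix_inv y ** matrix_inv x) = x ** (y ** matrix_inv y) ** matrix_inv x"
    by (simp add: matrix_mul_assoc)
  then have "x ** y ** (matrix_inv y ** matrix_inv x) = mat 1"
    using assms by (simp add: matrix_inv_inverse)
  from Ad_eq[OF this] show ?thesis by (simp add: Ad_def matrix_mul_assoc)
qed

lemma weyl_orbit_eq:
  fixes G H :: "'n::finite cmat set"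
  assumes G: "subgroup G GL" and H: "H \<subseteq> G" and h: "h \<in> Lie H" and h': "h' \<in> Lie H"
    and orbit: "h' \<in> weyl_orbit G H h"
  shows "weyl_orbit G H h' = weyl_orbit G H h"
proof -
  let ?N = "normalizer (grp G) H"
  note N = subgroup_GL[OF normalizer_subgroup_GL[OF G H]]
  obtain x where x: "x \<in> ?N" "h' = Ad x h" using orbit unfolding weyl_orbit_eq_Ad[OF h] by blast
  have xi: "invertible x" using x(1) N(1) by blast
  have "Ad y h' = Ad (y ** x) h" if "y \<in> ?N" for y
    using that N(1) xi unfolding x(2) by (subst Ad_mult) auto
  moreover have "Ad y h = Ad (y ** matrix_inv x) h'" if "y \<in> ?N" for y
  proof -
    have "invertible y" "invertible (matrix_inv x)" using that N(1,4) x(1) by blast+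
    then have "Ad (y ** matrix_inv x) h' = Ad (y ** matrix_inv x ** x) h"
      unfolding x(2) by (simp add: Ad_mult xi invertible_mult)
    then show ?thesis using matrix_inv_inverse(2)[OF xi] by (simp add: matrix_mul_assoc[symmetric])
  qed
  ultimately show ?thesis
    unfolding weyl_orbit_eq_Ad[OF h] weyl_orbit_eq_Ad[OF h']
    using N(3) N(4)[OF x(1)] x(1) by (intro equalityI subsetI; elim imageE) (metis imageI)+
qed

theorem theorem3:
  fixes G H \<bb> :: "'n::finite cmat set" and X h\<^sub>0 Y :: "'n cmat"
    and \<Sigma>' :: "'n cmat set \<Rightarrow> 'n cmat" and \<Sigma> :: "'n cmat \<Rightarrow> 'n cmat"
  assumes "simple_algebraic_group G" and "simply_connected G"
    and "maximal_torus G H"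
    and "borel_subalgebra (Lie G) \<bb>" and "Lie H \<subseteq> \<bb>"
    and "adapted_principal_sl2_triple G H \<bb> X h\<^sub>0 Y"
    and "kostant_section G H X h\<^sub>0 \<Sigma>'"
    and "\<And>h. h \<in> Lie H \<Longrightarrow> \<Sigma> h = \<Sigma>' (weyl_orbit G H h)"
  shows "\<exists>\<phi>. morphism (affine_variety (Lie H)) (group_variety G) \<phi> \<and>
              (\<forall>h\<in>Lie H. Ad (\<phi> h) (\<Sigma> h) = h + X)"
proof -
  have G: "linear_algebraic_group G" using assms(1) unfolding simple_algebraic_group_def by blast
  then have sub: "subgroup G GL" unfolding linear_algebraic_group_def by blast
  have H: "torus H" "H \<subseteq> G" using assms(3) unfolding maximal_torus_def by auto
  have Lie_H: "Lie H \<subseteq> Lie G" by (rule Lie_mono[OF H(2)])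
  have h0: "h\<^sub>0 \<in> Lie H" and X': "X \<in> Lie G" "lie h\<^sub>0 X = cscale 2 X"
    using assms(6)
    unfolding adapted_principal_sl2_triple_def principal_nilpotent_def nilpotent_element_def by auto
  have H_invertible: "H \<subseteq> {A. invertible A}" using H(2) subgroup_GL(1)[OF sub] by blast
  have comm: "lie h\<^sub>0 h = 0" if "h \<in> Lie H" for h
    by (rule Lie_commutative[OF H_invertible torus_commutative[OF H(1)] h0 that])
  obtain Z where Z: "Z \<subseteq> Lie G" "cmat.subspace Z" "\<forall>A\<in>Z. lie h\<^sub>0 A \<in> Z"
      and complement: "Lie G = {A + B |A B. A \<in> Z \<and> B \<in> lie X ` Lie G}"
      and iso: "inverse_isomorphisms (affine_variety ((\<lambda>A. A + X) ` Z)) (weyl_quotient G H)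
        (adjoint_quotient G H) \<Sigma>'"
    using assms(7) unfolding kostant_section_def by blast
  have quotient_s: "adjoint_quotient G H s \<in> weyl_orbit G H ` Lie H"
    and section_s: "\<Sigma>' (adjoint_quotient G H s) = s" if "s \<in> (\<lambda>A. A + X) ` Z" for s
    using iso that
    unfolding inverse_isomorphisms_def morphism_def affine_variety_def weyl_quotient_def
    by (simp_all only: variety.simps Pi_iff)
  interpret kostant_slice G Z "h\<^sub>0" X
    using G h0 Lie_H X' Z complement by unfold_locales auto
  obtain g g' where g': "regular_matrix_on matrix_entries UNIV g" "regular_matrix_on matrix_entries UNIV g'"
      and in_G: "\<And>h. h \<in> Lie H \<Longrightarrow> g h \<in> G" "\<And>h. h \<in> Lie H \<Longrightarrow> g' h \<in> G"
      and inverse: "\<And>h. h \<in> Lie H \<Longrightarrow> g h ** g' h = mat 1"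
      and slice: "\<And>h. h \<in> Lie H \<Longrightarrow> g h ** (h + X) ** g' h - X \<in> Z"
    using conjugate_into_slice[OF Lie_H comm] by blast
  have inverse': "g' h ** g h = mat 1" if "h \<in> Lie H" for h
    using inverse[OF that] matrix_left_right_inverse[of "g h" "g' h"] by blast
  have section_eq: "\<Sigma> h = g h ** (h + X) ** g' h" if h: "h \<in> Lie H" for h
  proof -
    define s where "s = g h ** (h + X) ** g' h"
    have s_Ad: "s = Ad (g h) (h + X)" unfolding s_def Ad_eq[OF inverse[OF h]] ..
    have hX: "h + X \<in> Lie G" using h Lie_H X'(1) cmat.subspace_add[OF Lie_subspace] by blast
    have f_s: "f s = f h" if f: "f \<in> invariant_polynomials G" for f
    proof -
      have "f s = f (h + X)"
        using f in_G(1)[OF h] hX unfolding s_Ad invariant_polynomials_def by blast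
      also have "\<dots> = f h"
        using h h0 Lie_H by (intro invariant_polynomial_shift[OF sub f _ _ X'(1) comm[OF h] X'(2)]) auto
      finally show ?thesis .
    qed
    have s: "s \<in> (\<lambda>A. A + X) ` Z"
      using slice[OF h] unfolding s_def by (rule rev_image_eqI) simp
    from quotient_s[OF s] obtain h1
      where h1: "adjoint_quotient G H s = weyl_orbit G H h1" "h1 \<in> Lie H" ..
    have "h \<in> adjoint_quotient G H s" unfolding adjoint_quotient_def
      by (intro CollectI conjI ballI h f_s[symmetric])
    then have "adjoint_quotient G H s = weyl_orbit G H h"
      using weyl_orbit_eq[OF sub H(2) h1(2) h] h1(1) by simp
    moreover have "\<Sigma>' (adjoint_quotient G H s) = s"
      by (rule section_s[OF s])
    ultimately show ?thesis using assms(8)[OF h] unfolding s_def by simp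
  qed
  show ?thesis
  proof (intro exI[of _ g'] conjI ballI)
    show "Ad (g' h) (\<Sigma> h) = h + X" if h: "h \<in> Lie H" for h
    proof -
      have "Ad (g' h) (\<Sigma> h) = (g' h ** g h) ** (h + X) ** (g' h ** g h)"
        unfolding section_eq[OF h] Ad_eq[OF inverse'[OF h]] by (simp add: matrix_mul_assoc)
      then show ?thesis by (simp only: inverse'[OF h] matrix_mul_lid matrix_mul_rid)
    qed
    have mono: "regular_matrix_on matrix_entries (Lie H) F"
      if "regular_matrix_on matrix_entries UNIV F" for F :: "'n cmat \<Rightarrow> 'n cmat"
      using that unfolding regular_matrix_on_def regular_on_def by blast
    have "\<exists>r\<in>polynomial_functions. \<forall>h\<in>Lie H. q (g' h) = r h" if "q \<in> GL_regular_functions" for q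
      using regular_on_compose_invertible[OF that mono[OF g'(2)] mono[OF g'(1)] inverse']
      unfolding regular_on_def polynomial_functions_def by blast
    then show "morphism (affine_variety (Lie H)) (group_variety G) g'"
      using in_G(2) unfolding morphism_def affine_variety_def group_variety_def by auto
  qed
qed

end
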